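(* Let $f_0$ and $g_0$ be non-negative radially symmetric measures on $\mathbb{R}^2$ related by $$\frac{1}{2\pi} f_0\big(\overline{B(0,r)}\big) = \log\Big(1+\frac{1}{2\pi}g_0\big(\overline{B(0,r)}\big)\Big)\qquad\text{for all } r\ge 0 ,$$ and let $f,g$ be non-negative functions on $(0,\infty)\times\mathbb{R}^2$, radially symmetric in $v$, related as follows: $|v| f(t,v)=\varphi(t,|v|)$ and $|v| g(t,v)=\psi(t,|v|)$ for $t>0$, $v\in\mathbb{R}^2$, where $$\varphi(t,r)=\partial_r\log\Big(1+\int_0^r\psi(t,s)\,\mathrm{d}s\Big)\qquad (t>0,\ r\ge 0),$$ or, equivalently, $\psi(t,r)=\partial_r\exp\big(\int_0^r\varphi(t,s)\,\mathrm{d}s\big)$. Then the following are equivalent: (1) $f$ is a classical solution to the Bose-Einstein-Fokker-Planck equation $\partial_t f=\Delta f+\mathrm{div}(v f(1+f))$ on $(0,\infty)\times\mathbb{R}^2$ with initial condition $f_0$; (2) $g$ is a classical solution to the linear Fokker-Planck equation $\partial_t g=\Delta g+\mathrm{div}(v g)$ on $(0,\infty)\times\mathbb{R}^2$ with initial condition $g_0$.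
   Context: A measure is always understood to be a non-negative Borel measure with finite total mass. $\overline{B(0,r)}$ is the closed ball of radius $r$ centred at $0$ in $\mathbb{R}^2$. $\mathcal{C}^1_t\mathcal{C}^2_v$ denotes the space of functions $f=f(t,v)$ on $(0,\infty)\times\mathbb{R}^2$ for which $f$, $\partial_t f$ and all partial derivatives of order up to $2$ with respect to $v$ exist and are continuous on $(0,\infty)\times\mathbb{R}^2$. The differential operators $\Delta$ and $\mathrm{div}$ act in the variable $v\in\mathbb{R}^2$. A classical solution of either of the two equations with initial condition a non-negative Borel measure $\mu_0$ on $\mathbb{R}^2$ is a function $u\in\mathcal{C}^1_t\mathcal{C}^2_v$ which satisfies the equation pointwise in $(0,\infty)\times\mathbb{R}^2$ and such that $\lim_{t\to0}u(t)=\mu_0$ in the weak-$*$ sense of measures on $\mathbb{R}^2$. The relation between $\varphi$ and $\psi$ can also be written as $\varphi(t,r)=\psi(t,r)/\big(1+\int_0^r\psi(t,s)\,\mathrm{d}s\big)$ and $\psi(t,r)=\varphi(t,r)\exp\big(\int_0^r\varphi(t,s)\,\mathrm{d}s\big)$.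
   Formalization: The relation between f and g is void at v=0, where changing one value of f would break the equivalence; f(t,0)=g(t,0) is therefore assumed. Both forms of the relation between φ and ψ, called equivalent, are required pointwise, since each alone misses changes on null sets. *)

theory Defs
  imports "HOL-Analysis.Analysis"
begin

subsection \<open>Differential operators\<close>

definition has_partial :: "'n::finite \<Rightarrow> (real^'n \<Rightarrow> real) \<Rightarrow> real^'n \<Rightarrow> bool" where
  "has_partial i h v \<longleftrightarrow> (\<lambda>s. h (v + s *\<^sub>R axis i 1)) field_differentiable (at 0)"

definition partial :: "'n::finite \<Rightarrow> (real^'n \<Rightarrow> real) \<Rightarrow> real^'n \<Rightarrow> real" where
  "partial i h v = deriv (\<lambda>s. h (v + s *\<^sub>R axis i 1)) 0"

definition laplacian :: "(real^'n::finite \<Rightarrow> real) \<Rightarrow> real^'n \<Rightarrow> real" where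
  "laplacian h v = (\<Sum>i\<in>UNIV. partial i (partial i h) v)"

definition divergence :: "(real^'n::finite \<Rightarrow> real^'n) \<Rightarrow> real^'n \<Rightarrow> real" where
  "divergence F v = (\<Sum>i\<in>UNIV. partial i (\<lambda>w. F w $ i) v)"

definition time_deriv :: "(real \<Rightarrow> 'a \<Rightarrow> real) \<Rightarrow> real \<Rightarrow> 'a \<Rightarrow> real" where
  "time_deriv u t v = deriv (\<lambda>s. u s v) t"

text \<open>A function on \<open>(0,\<infinity>) \<times> \<real>\<^sup>2\<close> is a total curried function of which only the values at
  \<open>t > 0\<close> are ever used.\<close>

definition continuous_pos_time :: "(real \<Rightarrow> real^2 \<Rightarrow> real) \<Rightarrow> bool" where
  "continuous_pos_time u \<longleftrightarrow> continuous_on ({0<..} \<times> UNIV) (\<lambda>(t, v). u t v)"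

definition C1t_C2v :: "(real \<Rightarrow> real^2 \<Rightarrow> real) \<Rightarrow> bool" where
  "C1t_C2v u \<longleftrightarrow>
     continuous_pos_time u \<and>
     (\<forall>t>0. \<forall>v. (\<lambda>s. u s v) field_differentiable (at t)) \<and>
     continuous_pos_time (time_deriv u) \<and>
     (\<forall>i. (\<forall>t>0. \<forall>v. has_partial i (u t) v) \<and>
          continuous_pos_time (\<lambda>t. partial i (u t))) \<and>
     (\<forall>i j. (\<forall>t>0. \<forall>v. has_partial i (partial j (u t)) v) \<and>
            continuous_pos_time (\<lambda>t. partial i (partial j (u t))))"

subsection \<open>Radial symmetry\<close>

definition radial_fun :: "(real^2 \<Rightarrow> real) \<Rightarrow> bool" where
  "radial_fun h \<longleftrightarrow> (\<forall>v w. norm v = norm w \<longrightarrow> h v = h w)"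

definition radial_measure :: "(real^2) measure \<Rightarrow> bool" where
  "radial_measure M \<longleftrightarrow> (\<forall>T. orthogonal_transformation T \<longrightarrow> distr M borel T = M)"

subsection \<open>Classical solutions\<close>

text \<open>Weak-* convergence is taken in the space of finite measures as the dual of
  \<open>C\<^sub>0(\<real>\<^sup>2)\<close>, the continuous functions vanishing at infinity; \<open>u(t)\<close> stands for
  the measure with Lebesgue density \<open>u(t, \<cdot>)\<close>. The integrability condition says that this
  measure is finite for small \<open>t\<close>; without it the Bochner integrals below could take
  the default value 0.\<close>

definition weak_star_initial :: "(real \<Rightarrow> real^2 \<Rightarrow> real) \<Rightarrow> (real^2) measure \<Rightarrow> bool" where
  "weak_star_initial u \<mu> \<longleftrightarrow>
     (\<forall>\<^sub>F t in at_right 0. integrable lborel (u t)) \<and>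
     (\<forall>h :: real^2 \<Rightarrow> real. continuous_on UNIV h \<and> (h \<longlongrightarrow> 0) at_infinity \<longrightarrow>
        ((\<lambda>t. \<integral>v. h v * u t v \<partial>lborel) \<longlongrightarrow> (\<integral>v. h v \<partial>\<mu>)) (at_right 0))"

text \<open>\<open>classical_solution L u \<mu>\<close>: \<open>u\<close> is a classical solution of
  \<open>\<partial>\<^sub>t u = L u\<close> with initial condition \<open>\<mu>\<close>, where \<open>L\<close> acts in \<open>v\<close> only.\<close>

definition classical_solution ::
    "((real^2 \<Rightarrow> real) \<Rightarrow> real^2 \<Rightarrow> real) \<Rightarrow> (real \<Rightarrow> real^2 \<Rightarrow> real) \<Rightarrow> (real^2) measure \<Rightarrow> bool" where
  "classical_solution L u \<mu> \<longleftrightarrow>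
     C1t_C2v u \<and> (\<forall>t>0. \<forall>v. time_deriv u t v = L (u t) v) \<and> weak_star_initial u \<mu>"

definition bose_einstein_fokker_planck :: "(real^2 \<Rightarrow> real) \<Rightarrow> real^2 \<Rightarrow> real" where
  "bose_einstein_fokker_planck h v =
     laplacian h v + divergence (\<lambda>w. (h w * (1 + h w)) *\<^sub>R w) v"

definition linear_fokker_planck :: "(real^2 \<Rightarrow> real) \<Rightarrow> real^2 \<Rightarrow> real" where
  "linear_fokker_planck h v = laplacian h v + divergence (\<lambda>w. h w *\<^sub>R w) v"

subsection \<open>The transformation between radial profiles\<close>

text \<open>The relation \<open>\<phi> = \<partial>\<^sub>r log (1 + \<integral>\<^sub>0\<^sup>r \<psi>)\<close>, equivalently
  \<open>\<psi> = \<partial>\<^sub>r exp (\<integral>\<^sub>0\<^sup>r \<phi>)\<close>, on \<open>[0,\<infinity>)\<close> (one-sided derivatives at 0).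
  For arbitrary functions the first identity does not see changes of \<open>\<psi>\<close> on null sets,
  and the second does not see changes of \<open>\<phi>\<close>, so the two are equivalent only when the
  integrands are derivatives of their integrals, e.g. continuous. Both are
  therefore required; together they give
  \<open>\<phi> = \<psi> / (1 + \<integral>\<^sub>0\<^sup>r \<psi>)\<close> and \<open>\<psi> = \<phi> exp (\<integral>\<^sub>0\<^sup>r \<phi>)\<close> pointwise.\<close>

definition log_exp_related :: "(real \<Rightarrow> real) \<Rightarrow> (real \<Rightarrow> real) \<Rightarrow> bool" where
  "log_exp_related \<phi> \<psi> \<longleftrightarrow>
     (\<forall>r\<ge>0. \<phi> integrable_on {0..r} \<and> \<psi> integrable_on {0..r}) \<and>
     (\<forall>r\<ge>0. ((\<lambda>x. ln (1 + integral {0..x} \<psi>)) has_real_derivative \<phi> r) (at r within {0..})) \<and>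
     (\<forall>r\<ge>0. ((\<lambda>x. exp (integral {0..x} \<phi>)) has_real_derivative \<psi> r) (at r within {0..}))"

text \<open>\<open>related_by_profiles f g \<phi> \<psi>\<close> is the relation \<open>|v| f(v) = \<phi>(|v|)\<close>,
  \<open>|v| g(v) = \<psi>(|v|)\<close> at a fixed time. At \<open>v = 0\<close> these equations are void. Since
  \<open>f(v) = g(v) / (1 + \<integral>\<^sub>0\<^bsup>|v|\<^esup> \<psi>)\<close> for \<open>v \<noteq> 0\<close>, the relation is extended to the
  origin by \<open>f(0) = g(0)\<close>, which is automatic when \<open>f\<close> and \<open>g\<close> are continuous there.\<close>

definition related_by_profiles ::
    "(real^2 \<Rightarrow> real) \<Rightarrow> (real^2 \<Rightarrow> real) \<Rightarrow> (real \<Rightarrow> real) \<Rightarrow> (real \<Rightarrow> real) \<Rightarrow> bool" where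
  "related_by_profiles f g \<phi> \<psi> \<longleftrightarrow>
     (\<forall>v. norm v * f v = \<phi> (norm v)) \<and> (\<forall>v. norm v * g v = \<psi> (norm v)) \<and>
     f 0 = g 0 \<and> log_exp_related \<phi> \<psi>"

end

theory Submission
  imports Defs
begin

text \<open>
  For radial \<open>u\<close> put \<open>n\<^sub>u(t,v) = \<integral>\<^sub>0\<^bsup>|v|\<^esup> s u(t,s) ds\<close>, so that \<open>2\<pi> n\<^sub>u\<close> is the mass of a ball and
  \<open>\<partial>\<^sub>i n\<^sub>u = v\<^sub>i u\<close>. The relation between the profiles says \<open>e\<^bsup>n\<^sub>f\<^esup> = 1 + n\<^sub>g\<close> and
  \<open>g = f e\<^bsup>n\<^sub>f\<^esup>\<close>, so \<open>f\<close> and \<open>g\<close> have the same regularity. Differentiating, \<open>\<partial>\<^sub>t g - L g\<close> equals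
  \<open>e\<^bsup>n\<^sub>f\<^esup>\<close> times \<open>\<partial>\<^sub>t f - B f + f (\<partial>\<^sub>t n\<^sub>f - v\<cdot>\<nabla>f - |v|\<^sup>2 f (1 + f))\<close>, where \<open>L\<close> and \<open>B\<close> are the
  linear and the Bose-Einstein operator. The last bracket vanishes as soon as either equation
  holds, because integrating a radial equation in divergence form over a ball gives the flux through
  its boundary.

  For the initial condition, weak-* convergence of radial measures is equivalent to boundedness of
  the masses together with convergence of the masses of almost all balls. The ball masses of \<open>f\<close>
  and \<open>g\<close> are monotone continuous functions of each other.
\<close>

section \<open>Partial derivatives and the class of regular functions\<close>

text \<open>The exponential is a Cole-Hopf substitution for the mass function. With r = |v| and r f
  = d/dr n_f, the Bose-Einstein equation integrated over discs reads n_t = n_rr - n_r / r + r n_r +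
  (n_r)^2. The only nonlinear term is the square of n_r, and N = e^n - 1 absorbs it: N_t = N_rr -
  N_r / r + r N_r, which is the linear Fokker-Planck equation integrated over discs. Differentiating
  these mass equations back in r would cost regularity, so the proof compares g = f e^(n_f) with f
  pointwise and uses the mass equations only to remove the nonlocal term.

  The comparison of the equations works disc by disc and needs no decay at infinity. Global mass
  enters only with the initial condition. Test functions vanish at infinity, so mass may escape and
  total masses need not converge; hence balls are compared, and only exponentials e^(-p|v|) with p >
  0 are used as test functions. The exceptional balls are those whose boundary circle is charged by
  the initial measure, at most countably many radii.\<close>

lemma radial_funD: "radial_fun h \<Longrightarrow> norm v = norm w \<Longrightarrow> h v = h w"
  unfolding radial_fun_def by blast

lemma continuous_pos_time_iff:
  "continuous_pos_time u \<longleftrightarrow> continuous_on ({0<..} \<times> UNIV) (\<lambda>p. u (fst p) (snd p))"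
  by (simp add: continuous_pos_time_def case_prod_beta)

lemma continuous_pos_time_mult:
  "continuous_pos_time u \<Longrightarrow> continuous_pos_time w \<Longrightarrow> continuous_pos_time (\<lambda>t v. u t v * w t v)"
  unfolding continuous_pos_time_iff by (intro continuous_intros)

lemma continuous_pos_time_add:
  "continuous_pos_time u \<Longrightarrow> continuous_pos_time w \<Longrightarrow> continuous_pos_time (\<lambda>t v. u t v + w t v)"
  unfolding continuous_pos_time_iff by (intro continuous_intros)

lemma continuous_pos_time_const: "continuous_pos_time (\<lambda>t v. c)"
  unfolding continuous_pos_time_iff by (intro continuous_intros)

lemma continuous_pos_time_component: "continuous_pos_time (\<lambda>t v. v $ i)"
  unfolding continuous_pos_time_iff by (intro continuous_intros)

lemma continuous_pos_time_compose:
  assumes "continuous_pos_time u" "continuous_on S F" "\<And>t v. t > 0 \<Longrightarrow> u t v \<in> S"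
  shows "continuous_pos_time (\<lambda>t v. F (u t v))"
  using assms unfolding continuous_pos_time_iff
  by (auto intro!: continuous_on_compose2[of S F])

lemma continuous_pos_time_cong:
  assumes "continuous_pos_time u" "\<And>t v. t > 0 \<Longrightarrow> w t v = u t v"
  shows "continuous_pos_time w"
  unfolding continuous_pos_time_iff
  by (rule continuous_on_eq[OF assms(1)[unfolded continuous_pos_time_iff]]) (auto simp: assms(2))

lemma continuous_pos_time_comp:
  assumes "continuous_pos_time u" "continuous_on A a" "continuous_on A b" "\<And>x. x \<in> A \<Longrightarrow> a x > 0"
  shows "continuous_on A (\<lambda>x. u (a x) (b x))"
  using continuous_on_compose2[OF assms(1)[unfolded continuous_pos_time_iff]
      continuous_on_Pair[OF assms(2,3)]] assms(4) by auto

lemma continuous_pos_time_section: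
  "continuous_pos_time u \<Longrightarrow> t > 0 \<Longrightarrow> continuous_on UNIV (u t)"
  using continuous_pos_time_comp[of u UNIV "\<lambda>_. t" "\<lambda>v. v"] by simp

lemma partial_eqI:
  "((\<lambda>s. h (v + s *\<^sub>R axis i 1)) has_field_derivative d) (at 0) \<Longrightarrow> partial i h v = d"
  by (simp add: partial_def DERIV_imp_deriv)

lemma partial_deriv_component:
  "((\<lambda>s. (v + s *\<^sub>R axis i 1) $ j) has_field_derivative (if i = j then 1 else 0)) (at (0::real))"
  by (auto intro!: derivative_eq_intros simp: axis_def)

section \<open>Calculus in the class \<open>C1t_C2v\<close>\<close>

lemma C1t_C2v_derivs:
  assumes "C1t_C2v u" "t > 0"
  shows "((\<lambda>s. u s v) has_field_derivative time_deriv u t v) (at t)"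
    and "((\<lambda>s. u t (v + s *\<^sub>R axis i 1)) has_field_derivative partial i (u t) v) (at 0)"
    and "((\<lambda>s. partial j (u t) (v + s *\<^sub>R axis i 1))
           has_field_derivative partial i (partial j (u t)) v) (at 0)"
  using assms
  by (simp_all add: C1t_C2v_def has_partial_def partial_def time_deriv_def
      DERIV_deriv_iff_field_differentiable)

lemma C1t_C2v_continuous:
  assumes "C1t_C2v u"
  shows "continuous_pos_time u" "continuous_pos_time (time_deriv u)"
    "continuous_pos_time (\<lambda>t. partial i (u t))"
    "continuous_pos_time (\<lambda>t. partial i (partial j (u t)))"
  using assms by (auto simp: C1t_C2v_def)

text \<open>The candidates for the derivatives are explicit functions because a second partial
  differentiates the function \<open>partial j (u t)\<close>: the first partials must be known on
  the whole plane before the second ones can be computed at a point.\<close>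

lemma C1t_C2vI:
  assumes "continuous_pos_time u"
    and dt: "\<And>t v. t > 0 \<Longrightarrow> ((\<lambda>s. u s v) has_field_derivative ut t v) (at t)"
    and "continuous_pos_time ut"
    and dx: "\<And>t v i. t > 0 \<Longrightarrow> ((\<lambda>s. u t (v + s *\<^sub>R axis i 1)) has_field_derivative ux i t v) (at 0)"
    and "\<And>i. continuous_pos_time (ux i)"
    and dxx: "\<And>t v i j. t > 0 \<Longrightarrow>
        ((\<lambda>s. ux j t (v + s *\<^sub>R axis i 1)) has_field_derivative uxx i j t v) (at 0)"
    and "\<And>i j. continuous_pos_time (uxx i j)"
  shows "C1t_C2v u"
    and "t > 0 \<Longrightarrow> time_deriv u t v = ut t v"
    and "t > 0 \<Longrightarrow> partial i (u t) v = ux i t v"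
    and "t > 0 \<Longrightarrow> partial i (partial j (u t)) v = uxx i j t v"
proof -
  have ut: "time_deriv u t v = ut t v" if "t > 0" for t v
    using dt[OF that] by (simp add: time_deriv_def DERIV_imp_deriv)
  have ux: "partial i (u t) v = ux i t v" if "t > 0" for t v i
    using dx[OF that] by (rule partial_eqI)
  have ux': "partial i (u t) = ux i t" if "t > 0" for t i
    using ux[OF that] by auto
  have uxx: "partial i (partial j (u t)) v = uxx i j t v" if "t > 0" for t v i j
    unfolding ux'[OF that] using dxx[OF that] by (rule partial_eqI)
  show "t > 0 \<Longrightarrow> time_deriv u t v = ut t v" "t > 0 \<Longrightarrow> partial i (u t) v = ux i t v"
    "t > 0 \<Longrightarrow> partial i (partial j (u t)) v = uxx i j t v"
    using ut ux uxx by auto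
  have "has_partial i (u t) v" if "t > 0" for t v i
    using dx[OF that] by (auto simp: has_partial_def field_differentiable_def)
  moreover have "has_partial i (partial j (u t)) v" if "t > 0" for t v i j
    unfolding ux'[OF that] using dxx[OF that] by (auto simp: has_partial_def field_differentiable_def)
  moreover have "(\<lambda>s. u s v) field_differentiable (at t)" if "t > 0" for t v
    using dt[OF that] by (auto simp: field_differentiable_def)
  moreover have "continuous_pos_time (time_deriv u)"
    by (rule continuous_pos_time_cong[OF assms(3)]) (rule ut)
  moreover have "continuous_pos_time (\<lambda>t. partial i (u t))" for i
    by (rule continuous_pos_time_cong[OF assms(5)]) (rule ux)
  moreover have "continuous_pos_time (\<lambda>t. partial i (partial j (u t)))" for i j
    by (rule continuous_pos_time_cong[OF assms(7)]) (rule uxx)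
  ultimately show "C1t_C2v u" using assms(1) by (simp add: C1t_C2v_def)
qed

lemma C1t_C2v_mult:
  assumes u: "C1t_C2v u" and w: "C1t_C2v w"
  shows "C1t_C2v (\<lambda>t v. u t v * w t v)"
proof (rule C1t_C2vI[where ut = "\<lambda>t v. time_deriv u t v * w t v + time_deriv w t v * u t v"
      and ux = "\<lambda>i t v. partial i (u t) v * w t v + partial i (w t) v * u t v"
      and uxx = "\<lambda>i j t v. partial i (partial j (u t)) v * w t v + partial i (w t) v * partial j (u t) v
        + (partial i (partial j (w t)) v * u t v + partial i (u t) v * partial j (w t) v)"])
  note cu = C1t_C2v_continuous[OF u] and cw = C1t_C2v_continuous[OF w]
  note ci = continuous_pos_time_add continuous_pos_time_mult cu cw
  show "continuous_pos_time (\<lambda>t v. u t v * w t v)" by (intro ci)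
  show "continuous_pos_time (\<lambda>t v. time_deriv u t v * w t v + time_deriv w t v * u t v)"
    by (intro ci)
  show "continuous_pos_time (\<lambda>t v. partial i (u t) v * w t v + partial i (w t) v * u t v)" for i
    by (intro ci)
  show "continuous_pos_time (\<lambda>t v. partial i (partial j (u t)) v * w t v + partial i (w t) v * partial j (u t) v
        + (partial i (partial j (w t)) v * u t v + partial i (u t) v * partial j (w t) v))" for i j
    by (intro ci)
  fix t :: real and v :: "real^2" and i j :: 2
  assume t: "t > 0"
  note du = C1t_C2v_derivs[OF u t] and dw = C1t_C2v_derivs[OF w t]
  show "((\<lambda>s. u s v * w s v) has_field_derivative
      time_deriv u t v * w t v + time_deriv w t v * u t v) (at t)"
    by (rule DERIV_mult[OF du(1) dw(1)])
  show "((\<lambda>s. u t (v + s *\<^sub>R axis i 1) * w t (v + s *\<^sub>R axis i 1)) has_field_derivative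
      partial i (u t) v * w t v + partial i (w t) v * u t v) (at 0)"
    using DERIV_mult[OF du(2) dw(2)] by simp
  show "((\<lambda>s. partial j (u t) (v + s *\<^sub>R axis i 1) * w t (v + s *\<^sub>R axis i 1) +
             partial j (w t) (v + s *\<^sub>R axis i 1) * u t (v + s *\<^sub>R axis i 1)) has_field_derivative
        partial i (partial j (u t)) v * w t v + partial i (w t) v * partial j (u t) v
        + (partial i (partial j (w t)) v * u t v + partial i (u t) v * partial j (w t) v)) (at 0)"
    using DERIV_add[OF DERIV_mult[OF du(3) dw(2)] DERIV_mult[OF dw(3) du(2)]] by simp
qed

text \<open>The set \<open>S\<close> admits outer functions with singularities elsewhere, such as
  \<open>inverse (1 + x)\<close> on the nonnegative half-line. Derivatives of \<open>F\<close> are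
  two-sided even at boundary points of \<open>S\<close>, so the chain rule applies where
  \<open>u\<close> touches the boundary.\<close>

lemma C1t_C2v_compose:
  assumes u: "C1t_C2v u" and uS: "\<And>t v. t > 0 \<Longrightarrow> u t v \<in> S"
    and F: "\<And>x. x \<in> S \<Longrightarrow> (F has_field_derivative F' x) (at x)"
    and F': "\<And>x. x \<in> S \<Longrightarrow> (F' has_field_derivative F'' x) (at x)"
    and F'': "continuous_on S F''"
  shows "C1t_C2v (\<lambda>t v. F (u t v))"
proof (rule C1t_C2vI[where ut = "\<lambda>t v. F' (u t v) * time_deriv u t v"
      and ux = "\<lambda>i t v. F' (u t v) * partial i (u t) v"
      and uxx = "\<lambda>i j t v. F'' (u t v) * partial i (u t) v * partial j (u t) v
         + partial i (partial j (u t)) v * F' (u t v)"])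
  note cu = C1t_C2v_continuous[OF u]
  have "continuous_on S F" "continuous_on S F'"
    using F F' by (blast intro: DERIV_continuous_on has_field_derivative_at_within)+
  then have cF: "continuous_pos_time (\<lambda>t v. F (u t v))" "continuous_pos_time (\<lambda>t v. F' (u t v))"
    "continuous_pos_time (\<lambda>t v. F'' (u t v))"
    using F'' uS cu(1) by (auto intro: continuous_pos_time_compose)
  note ci = continuous_pos_time_add continuous_pos_time_mult cu cF
  show "continuous_pos_time (\<lambda>t v. F (u t v))"
    "continuous_pos_time (\<lambda>t v. F' (u t v) * time_deriv u t v)"
    by (intro ci)+
  show "continuous_pos_time (\<lambda>t v. F' (u t v) * partial i (u t) v)" for i
    by (intro ci)
  show "continuous_pos_time (\<lambda>t v. F'' (u t v) * partial i (u t) v * partial j (u t) v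
         + partial i (partial j (u t)) v * F' (u t v))" for i j
    by (intro ci)
  fix t :: real and v :: "real^2" and i j :: 2
  assume t: "t > 0"
  note du = C1t_C2v_derivs[OF u t] and S = uS[OF t]
  show "((\<lambda>s. F (u s v)) has_field_derivative F' (u t v) * time_deriv u t v) (at t)"
    by (rule DERIV_chain2[OF F[OF S] du(1)])
  \<comment> \<open>The chain rule evaluates the inner function at parameter 0, hence the point in
    the unsimplified form \<open>v + 0 *\<^sub>R axis i 1\<close>.\<close>
  have F2: "(F has_field_derivative F' (u t v)) (at (u t (v + 0 *\<^sub>R axis i 1)))"
    and F3: "(F' has_field_derivative F'' (u t v)) (at (u t (v + 0 *\<^sub>R axis i 1)))"
    using F[OF S] F'[OF S] by simp_all
  show "((\<lambda>s. F (u t (v + s *\<^sub>R axis i 1))) has_field_derivative F' (u t v) * partial i (u t) v) (at 0)"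
    by (rule DERIV_chain2[OF F2 du(2)])
  show "((\<lambda>s. F' (u t (v + s *\<^sub>R axis i 1)) * partial j (u t) (v + s *\<^sub>R axis i 1)) has_field_derivative
      F'' (u t v) * partial i (u t) v * partial j (u t) v
         + partial i (partial j (u t)) v * F' (u t v)) (at 0)"
    using DERIV_mult[OF DERIV_chain2[OF F3 du(2)] du(3)] by simp
qed

section \<open>The radial primitive\<close>

text \<open>For radial \<open>u\<close> this is \<open>\<integral>\<^sub>0\<^bsup>|v|\<^esup> s u(s) ds\<close>, rescaled to a fixed interval
  so that it can be differentiated under the integral sign.\<close>

definition radial_primitive :: "(real^2 \<Rightarrow> real) \<Rightarrow> real^2 \<Rightarrow> real" where
  "radial_primitive u v = integral {0..1} (\<lambda>\<sigma>. \<sigma> * (v \<bullet> v) * u (\<sigma> *\<^sub>R v))"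

text \<open>In terms of \<open>|v|\<^sup>2\<close> the primitive is differentiable up to the origin.\<close>

lemma radial_primitive_profile:
  assumes cont: "continuous_on UNIV u" and rad: "radial_fun u"
  obtains M where "\<And>q. q \<ge> 0 \<Longrightarrow> (M has_field_derivative u (sqrt q *\<^sub>R axis 1 1) / 2) (at q)"
    and "\<And>v. radial_primitive u v = M (v \<bullet> v)" and "M 0 = 0"
    and "\<And>v. ((\<lambda>\<sigma>. \<sigma> * (v \<bullet> v) * u (\<sigma> *\<^sub>R v)) has_integral radial_primitive u v) {0..1}"
proof -
  \<comment> \<open>The substitution q = s^2 turns s ds into dq / 2, which explains the factor 1/2.
    The even extension to q < 0 and the lower limit -1 make \<open>M\<close> differentiable from
    both sides at q = 0, that is, at the origin of the plane.\<close>
  define h where "h q = u (sqrt \<bar>q\<bar> *\<^sub>R axis 1 1) / 2" for q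
  define M where "M q = integral {-1..q} h - integral {-1..0} h" for q
  have h: "continuous_on A h" for A
    unfolding h_def by (intro continuous_intros continuous_on_compose2[OF cont]) auto
  have M: "(M has_field_derivative h q) (at q)" if "q \<ge> 0" for q
  proof -
    have "((\<lambda>x. integral {-1..x} h) has_vector_derivative h q) (at q within {-1..q+1})"
      by (rule integral_has_vector_derivative) (use that h in auto)
    then have "((\<lambda>x. integral {-1..x} h) has_field_derivative h q) (at q)"
      using that by (simp add: at_within_Icc_at has_real_derivative_iff_has_vector_derivative)
    then show ?thesis unfolding M_def by (auto intro!: derivative_eq_intros)
  qed
  have M0: "M 0 = 0" by (simp add: M_def)
  have int: "((\<lambda>\<sigma>. \<sigma> * (v \<bullet> v) * u (\<sigma> *\<^sub>R v)) has_integral M (v \<bullet> v)) {0..1}" for v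
  proof -
    have "((\<lambda>\<sigma>. \<sigma> * (v \<bullet> v) * u (\<sigma> *\<^sub>R v)) has_integral M (1\<^sup>2 * (v \<bullet> v)) - M (0\<^sup>2 * (v \<bullet> v))) {0..1}"
    proof (rule fundamental_theorem_of_calculus)
      fix \<sigma> :: real assume "\<sigma> \<in> {0..1}"
      have "u (sqrt \<bar>\<sigma>\<^sup>2 * (v \<bullet> v)\<bar> *\<^sub>R axis 1 1) = u (\<sigma> *\<^sub>R v)"
        by (rule radial_funD[OF rad])
           (simp add: real_sqrt_mult norm_eq_sqrt_inner abs_mult)
      moreover have "((\<lambda>\<sigma>. \<sigma>\<^sup>2 * (v \<bullet> v)) has_field_derivative 2 * \<sigma> * (v \<bullet> v)) (at \<sigma>)"
        by (auto intro!: derivative_eq_intros)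
      note DERIV_chain2[OF M this]
      ultimately have "((\<lambda>\<sigma>. M (\<sigma>\<^sup>2 * (v \<bullet> v))) has_field_derivative \<sigma> * (v \<bullet> v) * u (\<sigma> *\<^sub>R v)) (at \<sigma>)"
        by (simp add: h_def mult_ac)
      then show "((\<lambda>\<sigma>. M (\<sigma>\<^sup>2 * (v \<bullet> v))) has_vector_derivative \<sigma> * (v \<bullet> v) * u (\<sigma> *\<^sub>R v))
          (at \<sigma> within {0..1})"
        by (simp add: has_real_derivative_iff_has_vector_derivative has_vector_derivative_at_within)
    qed simp
    then show ?thesis by (simp add: M0)
  qed
  then have P: "radial_primitive u v = M (v \<bullet> v)" for v
    unfolding radial_primitive_def by (rule integral_unique)
  show ?thesis
    by (rule that[of M]) (use M M0 P int in \<open>auto simp: h_def\<close>)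
qed

lemma inner_line_deriv:
  "((\<lambda>s. (v + s *\<^sub>R axis i 1) \<bullet> (v + s *\<^sub>R axis i 1)) has_field_derivative 2 * v $ i) (at 0)"
  for v :: "real^'n"
proof -
  have *: "(v + s *\<^sub>R axis i 1) \<bullet> (v + s *\<^sub>R axis i 1) = v \<bullet> v + 2 * s * v $ i + s\<^sup>2" for s
    by (simp add: inner_add_left inner_add_right inner_axis inner_commute[of "axis i 1"]
        power2_eq_square algebra_simps)
  show ?thesis unfolding * by (auto intro!: derivative_eq_intros)
qed

text \<open>Since the primitive is a differentiable function of \<open>v \<bullet> v\<close>, the
  origin is not exceptional. Continuity of \<open>u\<close> suffices: the primitive gains one
  derivative in \<open>v\<close>.\<close>

lemma radial_primitive_deriv:
  assumes "continuous_on UNIV u" "radial_fun u"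
  shows "((\<lambda>s. radial_primitive u (v + s *\<^sub>R axis i 1)) has_field_derivative v $ i * u v) (at 0)"
proof -
  obtain M where M: "\<And>q. q \<ge> 0 \<Longrightarrow> (M has_field_derivative u (sqrt q *\<^sub>R axis 1 1) / 2) (at q)"
    "\<And>v. radial_primitive u v = M (v \<bullet> v)"
    using radial_primitive_profile[OF assms] by metis
  have u: "u (norm v *\<^sub>R axis 1 1) = u v"
    by (rule radial_funD[OF assms(2)]) simp
  have "(M has_field_derivative u v / 2) (at ((v + 0 *\<^sub>R axis i 1) \<bullet> (v + 0 *\<^sub>R axis i 1)))"
    using M(1)[of "v \<bullet> v"] u by (simp add: norm_eq_sqrt_inner)
  from DERIV_chain2[OF this inner_line_deriv[of v i]] show ?thesis by (simp add: M(2) mult.commute)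
qed

lemma radial_primitive_has_integral:
  assumes "continuous_on UNIV u" "radial_fun u" "r \<ge> 0" "norm e = 1"
  shows "((\<lambda>s. s * u (s *\<^sub>R e)) has_integral radial_primitive u (r *\<^sub>R e)) {0..r}"
proof -
  obtain M where M: "\<And>q. q \<ge> 0 \<Longrightarrow> (M has_field_derivative u (sqrt q *\<^sub>R axis 1 1) / 2) (at q)"
    "\<And>v. radial_primitive u v = M (v \<bullet> v)" "M 0 = 0"
    using radial_primitive_profile[OF assms(1,2)] by metis
  have "((\<lambda>s. s * u (s *\<^sub>R e)) has_integral M (r\<^sup>2) - M (0\<^sup>2)) {0..r}"
  proof (rule fundamental_theorem_of_calculus)
    fix s assume s: "s \<in> {0..r}"
    have "u (sqrt (s\<^sup>2) *\<^sub>R axis 1 1) = u (s *\<^sub>R e)"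
      by (rule radial_funD[OF assms(2)]) (simp add: assms)
    moreover have "((\<lambda>s. s\<^sup>2) has_field_derivative 2 * s) (at s)"
      by (auto intro!: derivative_eq_intros)
    note DERIV_chain2[OF M(1) this]
    ultimately have "((\<lambda>s. M (s\<^sup>2)) has_field_derivative s * u (s *\<^sub>R e)) (at s)"
      by (simp add: mult_ac)
    then show "((\<lambda>s. M (s\<^sup>2)) has_vector_derivative s * u (s *\<^sub>R e)) (at s within {0..r})"
      by (simp add: has_real_derivative_iff_has_vector_derivative has_vector_derivative_at_within)
  qed (rule assms)
  moreover have "e \<bullet> e = 1" using assms(4) by (simp add: norm_eq_1)
  ultimately show ?thesis by (simp add: M(2,3) power2_eq_square)
qed

lemma radial_primitive_0 [simp]: "radial_primitive u 0 = 0"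
  by (simp add: radial_primitive_def)

lemma radial_primitive_nonneg:
  assumes "\<And>v. u v \<ge> 0"
  shows "radial_primitive u v \<ge> 0"
  unfolding radial_primitive_def
  \<comment> \<open>A nonintegrable integrand gives the default value 0, which is also
    nonnegative.\<close>
  by (cases "(\<lambda>\<sigma>. \<sigma> * (v \<bullet> v) * u (\<sigma> *\<^sub>R v)) integrable_on {0..1}")
     (auto intro!: integral_nonneg simp: assms not_integrable_integral)

lemma continuous_pos_time_radial_primitive:
  assumes "continuous_pos_time u"
  shows "continuous_pos_time (\<lambda>t. radial_primitive (u t))"
proof -
  have "continuous_on ({0<..} \<times> UNIV)
      (\<lambda>p. integral (cbox 0 1) (\<lambda>\<sigma>. \<sigma> * (snd p \<bullet> snd p) * u (fst p) (\<sigma> *\<^sub>R snd p)))"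
  proof (rule integral_continuous_on_param)
    show "continuous_on (({0<..} \<times> UNIV) \<times> cbox 0 1)
        (\<lambda>(p, \<sigma>). \<sigma> * (snd p \<bullet> snd p) * u (fst p) (\<sigma> *\<^sub>R snd p))"
      unfolding case_prod_beta
      by (intro continuous_on_mult continuous_on_inner continuous_pos_time_comp[OF assms]
          continuous_on_scaleR continuous_on_fst continuous_on_snd continuous_on_id) auto
  qed
  then show ?thesis by (simp add: continuous_pos_time_iff radial_primitive_def)
qed

lemma radial_primitive_time_deriv:
  assumes u: "C1t_C2v u" and t: "t > 0"
  shows "((\<lambda>s. radial_primitive (u s) v) has_field_derivative radial_primitive (time_deriv u t) v) (at t)"
proof -
  \<comment> \<open>The Leibniz rule wants a convex parameter set; \<open>{0<..}\<close> is also
    open, so the resulting derivative is two-sided.\<close>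
  have "((\<lambda>s. integral (cbox 0 1) (\<lambda>\<sigma>. \<sigma> * (v \<bullet> v) * u s (\<sigma> *\<^sub>R v))) has_field_derivative
      integral (cbox 0 1) (\<lambda>\<sigma>. \<sigma> * (v \<bullet> v) * time_deriv u t (\<sigma> *\<^sub>R v))) (at t within {0<..})"
  proof (rule leibniz_rule_field_derivative)
    fix s \<sigma> :: real assume "s \<in> {0<..}"
    then show "((\<lambda>s. \<sigma> * (v \<bullet> v) * u s (\<sigma> *\<^sub>R v)) has_field_derivative
        \<sigma> * (v \<bullet> v) * time_deriv u s (\<sigma> *\<^sub>R v)) (at s within {0<..})"
      by (auto intro: DERIV_cmult[OF has_field_derivative_at_within[OF C1t_C2v_derivs(1)[OF u]]])
  next
    fix s :: real assume s: "s \<in> {0<..}"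
    show "(\<lambda>\<sigma>. \<sigma> * (v \<bullet> v) * u s (\<sigma> *\<^sub>R v)) integrable_on cbox 0 1"
      using s by (intro integrable_continuous continuous_on_mult continuous_on_const continuous_on_id
          continuous_on_scaleR continuous_pos_time_comp[OF C1t_C2v_continuous(1)[OF u]]) auto
  next
    show "continuous_on ({0<..} \<times> cbox 0 1) (\<lambda>(s, \<sigma>). \<sigma> * (v \<bullet> v) * time_deriv u s (\<sigma> *\<^sub>R v))"
      unfolding case_prod_beta
      by (intro continuous_on_mult continuous_on_const continuous_on_fst continuous_on_snd continuous_on_id
          continuous_on_scaleR continuous_pos_time_comp[OF C1t_C2v_continuous(2)[OF u]]) auto
  qed (use t in auto)
  then show ?thesis using t by (simp add: radial_primitive_def at_within_open[of t "{0<..}"])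
qed

text \<open>The first partials of the primitive are v_i u, so its second partials use only first
  partials of \<open>u\<close>, and the time derivative passes under the integral. The class is
  therefore stable under taking primitives.\<close>

lemma C1t_C2v_radial_primitive:
  assumes u: "C1t_C2v u" and rad: "\<And>t. t > 0 \<Longrightarrow> radial_fun (u t)"
  shows "C1t_C2v (\<lambda>t. radial_primitive (u t))"
    and "t > 0 \<Longrightarrow> time_deriv (\<lambda>t. radial_primitive (u t)) t v = radial_primitive (time_deriv u t) v"
    and "t > 0 \<Longrightarrow> partial i (radial_primitive (u t)) v = v $ i * u t v"
proof -
  note cu = C1t_C2v_continuous[OF u]
  note ci = continuous_pos_time_add continuous_pos_time_mult continuous_pos_time_const
    continuous_pos_time_component cu
  have cu': "continuous_on UNIV (u t)" if "t > 0" for t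
    using continuous_pos_time_section[OF cu(1) that] .
  note I = C1t_C2vI[of "\<lambda>t. radial_primitive (u t)" "\<lambda>t. radial_primitive (time_deriv u t)"
      "\<lambda>i t v. v $ i * u t v"
      "\<lambda>i j t v. (if i = j then 1 else 0) * u t v + partial i (u t) v * v $ j"]
  have 1: "((\<lambda>s. (v + s *\<^sub>R axis i 1) $ j * u t (v + s *\<^sub>R axis i 1)) has_field_derivative
      (if i = j then 1 else 0) * u t v + partial i (u t) v * v $ j) (at 0)" if "t > 0" for i j t v
    using DERIV_mult[OF partial_deriv_component C1t_C2v_derivs(2)[OF u that], of v i j v i] by simp
  have 2: "continuous_pos_time (\<lambda>t v. (if i = j then 1 else 0) * u t v + partial i (u t) v * v $ j)" for i j
    by (intro ci)
  have 3: "continuous_pos_time (\<lambda>t v. v $ i * u t v)" for i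
    by (intro ci)
  note I' = I[OF continuous_pos_time_radial_primitive[OF cu(1)] radial_primitive_time_deriv[OF u]
      continuous_pos_time_radial_primitive[OF cu(2)] radial_primitive_deriv[OF cu' rad] 3 1 2]
  show "C1t_C2v (\<lambda>t. radial_primitive (u t))"
    "t > 0 \<Longrightarrow> time_deriv (\<lambda>t. radial_primitive (u t)) t v = radial_primitive (time_deriv u t) v"
    "t > 0 \<Longrightarrow> partial i (radial_primitive (u t)) v = v $ i * u t v"
    using I' by blast+
qed

section \<open>The transformation of radial profiles\<close>

text \<open>The derivative formula for the exponential, integrated from 0, gives the first identity.
  It identifies \<open>ln (1 + integral {0..x} \<psi>)\<close> with the integral of \<phi>, so the
  exponential gets a second derivative formula from the logarithmic relation, and uniqueness of
  derivatives gives the second identity at every point, not just almost everywhere.\<close>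

lemma log_exp_related_imp:
  assumes rel: "log_exp_related \<phi> \<psi>" and r: "r \<ge> 0"
  shows "exp (integral {0..r} \<phi>) = 1 + integral {0..r} \<psi>"
    and "\<psi> r = \<phi> r * exp (integral {0..r} \<phi>)"
proof -
  let ?\<Phi> = "\<lambda>x. integral {0..x} \<phi>" and ?\<Psi> = "\<lambda>x. integral {0..x} \<psi>"
  have d\<Phi>: "((\<lambda>x. exp (?\<Phi> x)) has_real_derivative \<psi> x) (at x within {0..})" if "x \<ge> 0" for x
    using rel that by (simp add: log_exp_related_def)
  have eq: "exp (?\<Phi> x) = 1 + ?\<Psi> x" if x: "x \<ge> 0" for x
  proof -
    have "(\<psi> has_integral exp (?\<Phi> x) - exp (?\<Phi> 0)) {0..x}"
      by (rule fundamental_theorem_of_calculus)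
         (use x in \<open>auto simp flip: has_real_derivative_iff_has_vector_derivative
            intro: DERIV_subset[OF d\<Phi>]\<close>)
    then show ?thesis by (simp add: integral_unique)
  qed
  then show "exp (?\<Phi> r) = 1 + ?\<Psi> r" using r .
  have "((\<lambda>x. exp (ln (1 + ?\<Psi> x))) has_real_derivative exp (ln (1 + ?\<Psi> r)) * \<phi> r) (at r within {0..})"
    using rel r unfolding log_exp_related_def
    by (intro DERIV_chain2[OF DERIV_exp]) auto
  then have "((\<lambda>x. exp (?\<Phi> x)) has_real_derivative exp (?\<Phi> r) * \<phi> r) (at r within {0..})"
  proof (rule has_field_derivative_transform_within[where d = 1, THEN DERIV_cong])
    show "exp (ln (1 + ?\<Psi> x)) = exp (?\<Phi> x)" if "x \<in> {0..}" for x
      using eq[of x] that by (metis atLeast_iff ln_exp)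
    show "exp (ln (1 + ?\<Psi> r)) * \<phi> r = exp (?\<Phi> r) * \<phi> r"
      unfolding eq[OF r, symmetric] by simp
  qed (use r in auto)
  \<comment> \<open>Uniqueness of the derivative within \<open>{0..}\<close> requires a nontrivial
    filter; at r = 0 only the right side is available.\<close>
  moreover have "at r within {0..} \<noteq> bot"
  proof -
    have "at r within {r..r+1} \<noteq> bot"
      by (simp add: at_within_Icc_at_right)
    moreover have "at r within {r..r+1} \<le> at r within {0..}"
      using r by (intro at_le) auto
    ultimately show ?thesis by (metis bot.extremum_uniqueI)
  qed
  ultimately have "\<psi> r = exp (?\<Phi> r) * \<phi> r"
    using d\<Phi>[OF r] vector_derivative_unique_within[of r "{0..}"]
    unfolding has_real_derivative_iff_has_vector_derivative by blast
  then show "\<psi> r = \<phi> r * exp (?\<Phi> r)" by simp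
qed

text \<open>Stretching by r undoes the rescaling. Integrability along one ray is enough, so this
  applies to \<open>f t\<close> and \<open>g t\<close> before any regularity is known.\<close>

lemma radial_primitive_eqI:
  assumes int: "((\<lambda>s. s * u (s *\<^sub>R e)) has_integral I) {0..r}" and r: "r \<ge> 0" and e: "norm e = 1"
  shows "radial_primitive u (r *\<^sub>R e) = I"
proof (cases "r = 0")
  case True
  then show ?thesis using int by (auto dest: has_integral_unique)
next
  case False
  have ee: "e \<bullet> e = 1" using e by (simp add: norm_eq_1)
  have im: "(\<lambda>x. x / r) ` {0..r} = {0..1}"
    using False r by (auto simp: image_iff divide_simps intro!: bexI[of _ "_ * r"])
  have "((\<lambda>\<sigma>. r * ((r * \<sigma>) * u ((r * \<sigma>) *\<^sub>R e))) has_integral r * ((1 / \<bar>r\<bar>) * I)) {0..1}"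
    using has_integral_mult_right[OF has_integral_stretch_real[OF int False], of r]
    by (simp add: im)
  moreover have "(\<lambda>\<sigma>. r * ((r * \<sigma>) * u ((r * \<sigma>) *\<^sub>R e)))
      = (\<lambda>\<sigma>. \<sigma> * (r *\<^sub>R e \<bullet> r *\<^sub>R e) * u (\<sigma> *\<^sub>R r *\<^sub>R e))"
    by (auto simp: ee mult_ac)
  ultimately show ?thesis
    unfolding radial_primitive_def using False r by (auto dest: integral_unique)
qed

lemma radial_fun_radial_primitive:
  assumes "radial_fun u"
  shows "radial_fun (radial_primitive u)"
  unfolding radial_fun_def
proof (intro allI impI)
  fix v w :: "real^2" assume *: "norm v = norm w"
  have "u (\<sigma> *\<^sub>R v) = u (\<sigma> *\<^sub>R w)" for \<sigma>
    by (rule radial_funD[OF assms]) (simp add: *)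
  moreover have "v \<bullet> v = w \<bullet> w" using * by (simp add: norm_eq_sqrt_inner)
  ultimately show "radial_primitive u v = radial_primitive u w"
    by (simp add: radial_primitive_def)
qed

lemma related_by_profiles_imp:
  assumes rel: "related_by_profiles f g \<phi> \<psi>" and rad: "radial_fun f" "radial_fun g"
  shows "exp (radial_primitive f v) = 1 + radial_primitive g v"
    and "g v = f v * exp (radial_primitive f v)"
proof -
  have le: "log_exp_related \<phi> \<psi>" and \<phi>: "norm v * f v = \<phi> (norm v)"
    and \<psi>: "norm v * g v = \<psi> (norm v)" and 0: "f 0 = g 0" for v
    using rel by (auto simp: related_by_profiles_def)
  have prim: "radial_primitive u v = integral {0..norm v} \<xi>"
    if u: "radial_fun u" and \<xi>: "\<And>v. norm v * u v = \<xi> (norm v)"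
      and int: "\<xi> integrable_on {0..norm v}" for u \<xi>
  proof -
    have "s * u (s *\<^sub>R axis 1 1) = \<xi> s" if "s \<in> {0..norm v}" for s
      using \<xi>[of "s *\<^sub>R axis 1 1"] that by simp
    then have "((\<lambda>s. s * u (s *\<^sub>R axis 1 1)) has_integral integral {0..norm v} \<xi>) {0..norm v}"
      by (rule has_integral_eq[OF sym integrable_integral[OF int]])
    then have "radial_primitive u (norm v *\<^sub>R axis 1 1) = integral {0..norm v} \<xi>"
      by (rule radial_primitive_eqI) auto
    then show ?thesis
      using radial_funD[OF radial_fun_radial_primitive[OF u], of v "norm v *\<^sub>R axis 1 1"] by simp
  qed
  have int: "\<phi> integrable_on {0..norm v}" "\<psi> integrable_on {0..norm v}"
    using le by (auto simp: log_exp_related_def)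
  note p = prim[OF rad(1) \<phi> int(1)] prim[OF rad(2) \<psi> int(2)]
  note le' = log_exp_related_imp[OF le norm_ge_zero[of v]]
  show "exp (radial_primitive f v) = 1 + radial_primitive g v"
    using le'(1) by (simp add: p)
  show "g v = f v * exp (radial_primitive f v)"
  \<comment> \<open>Away from the origin the factor \<open>norm v\<close> cancels; at the origin the
    primitive is 0 and the convention \<open>f 0 = g 0\<close> takes over.\<close>
  proof (cases "v = 0")
    case False
    have "norm v * g v = norm v * (f v * exp (radial_primitive f v))"
      using le'(2) by (simp add: p \<phi>[symmetric] \<psi>[symmetric])
    then show ?thesis using False by simp
  qed (simp add: 0)
qed

section \<open>Regularity passes through the transformation\<close>

lemma C1t_C2v_cong:
  assumes u: "C1t_C2v u" and eq: "\<And>t v. t > 0 \<Longrightarrow> w t v = u t v"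
  shows "C1t_C2v w"
proof (rule C1t_C2vI[where ut = "time_deriv u" and ux = "\<lambda>i t. partial i (u t)"
      and uxx = "\<lambda>i j t. partial i (partial j (u t))"])
  note cu = C1t_C2v_continuous[OF u]
  show "continuous_pos_time w" using cu(1) eq by (rule continuous_pos_time_cong)
  show "continuous_pos_time (time_deriv u)" "continuous_pos_time (\<lambda>t. partial i (u t))"
    "continuous_pos_time (\<lambda>t. partial i (partial j (u t)))" for i j by (rule cu)+
  fix t :: real and v :: "real^2" and i j :: 2
  assume t: "t > 0"
  have eq': "w t = u t" using eq[OF t] by auto
  note du = C1t_C2v_derivs[OF u t]
  show "((\<lambda>s. w s v) has_field_derivative time_deriv u t v) (at t)"
    \<comment> \<open>The functions agree only for positive times, so the time derivative is
      transferred on the open half-line.\<close>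
    by (rule has_field_derivative_transform_within_open[OF du(1), of "{0<..}"]) (use t eq in auto)
  show "((\<lambda>s. w t (v + s *\<^sub>R axis i 1)) has_field_derivative partial i (u t) v) (at 0)"
    "((\<lambda>s. partial j (u t) (v + s *\<^sub>R axis i 1)) has_field_derivative
        partial i (partial j (u t)) v) (at 0)"
    using du(2,3) by (simp_all add: eq')
qed

lemma C1t_C2v_exp_transform:
  assumes f: "C1t_C2v f" and rad: "\<And>t. t > 0 \<Longrightarrow> radial_fun (f t)"
    and eq: "\<And>t v. t > 0 \<Longrightarrow> g t v = f t v * exp (radial_primitive (f t) v)"
  shows "C1t_C2v g"
proof (rule C1t_C2v_cong[OF C1t_C2v_mult[OF f C1t_C2v_compose[OF C1t_C2v_radial_primitive(1)[OF f rad],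
        where S = UNIV and F = exp and F' = exp and F'' = exp]] eq])
  show "continuous_on UNIV (exp :: real \<Rightarrow> real)" by (intro continuous_intros)
qed (auto intro: DERIV_exp)

lemma C1t_C2v_log_transform:
  assumes g: "C1t_C2v g" and rad: "\<And>t. t > 0 \<Longrightarrow> radial_fun (g t)"
    and nonneg: "\<And>t v. t > 0 \<Longrightarrow> g t v \<ge> 0"
    and eq: "\<And>t v. t > 0 \<Longrightarrow> f t v = g t v * inverse (1 + radial_primitive (g t) v)"
  shows "C1t_C2v f"
proof (rule C1t_C2v_cong[OF C1t_C2v_mult[OF g C1t_C2v_compose[OF C1t_C2v_radial_primitive(1)[OF g rad],
        where S = "{0..}" and F = "\<lambda>x. inverse (1 + x)" and F' = "\<lambda>x. - (inverse (1 + x))\<^sup>2"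
        and F'' = "\<lambda>x. 2 * inverse (1 + x) ^ 3"]] eq])
  \<comment> \<open>Nonnegativity of \<open>g\<close> keeps the denominator at least 1.\<close>
  show "radial_primitive (g t) v \<in> {0..}" if "t > 0" for t v
    using radial_primitive_nonneg[of "g t" v] nonneg[OF that] by simp
  show "((\<lambda>x. inverse (1 + x)) has_real_derivative - (inverse (1 + x))\<^sup>2) (at x)" if "x \<in> {0..}" for x :: real
    using that by (auto intro!: derivative_eq_intros simp: power2_eq_square)
  show "((\<lambda>x. - (inverse (1 + x))\<^sup>2) has_real_derivative 2 * inverse (1 + x) ^ 3) (at x)" if "x \<in> {0..}" for x :: real
    using that by (auto intro!: derivative_eq_intros simp: power2_eq_square power3_eq_cube)
  show "continuous_on {0..} (\<lambda>x::real. 2 * inverse (1 + x) ^ 3)"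
    by (intro continuous_intros) auto
qed auto

section \<open>The differential operators on radial functions\<close>

lemma norm_line_deriv:
  fixes v :: "real^'n"
  assumes "v \<noteq> 0"
  shows "((\<lambda>s. norm (v + s *\<^sub>R axis i 1)) has_field_derivative v $ i / norm v) (at 0)"
proof -
  let ?g = "\<lambda>s. (v + s *\<^sub>R axis i 1) \<bullet> (v + s *\<^sub>R axis i 1)"
  have "?g 0 > 0" using assms by simp
  from DERIV_chain2[where g = ?g, OF DERIV_real_sqrt[OF this] inner_line_deriv]
  have "((\<lambda>s. sqrt (?g s)) has_field_derivative inverse (sqrt (?g 0)) / 2 * (2 * v $ i)) (at 0)" .
  moreover have "inverse (sqrt (?g 0)) / 2 * (2 * v $ i) = v $ i / sqrt (v \<bullet> v)"
    by (simp only: scaleR_zero_left add_0_right divide_inverse mult.commute mult.left_commute) simp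
  ultimately show ?thesis
    by (simp only: norm_eq_sqrt_inner)
qed

text \<open>A radial function is its restriction to the first axis composed with the norm;
  \<open>d\<close> is the derivative of that restriction.\<close>

lemma radial_partial:
  assumes rad: "radial_fun h" and v: "v \<noteq> 0"
    and d: "((\<lambda>s. h (norm v *\<^sub>R axis 1 1 + s *\<^sub>R axis 1 1)) has_field_derivative d) (at 0)"
  shows "partial i h v = d * (v $ i / norm v)"
proof -
  have "((\<lambda>\<rho>. h (\<rho> *\<^sub>R axis 1 1)) has_field_derivative d) (at (norm v))"
    using d DERIV_shift[of "\<lambda>\<rho>. h (\<rho> *\<^sub>R axis 1 1)" d 0 "norm v"]
    by (simp add: scaleR_add_left add.commute)
  then have "((\<lambda>\<rho>. h (\<rho> *\<^sub>R axis 1 1)) has_field_derivative d) (at (norm (v + 0 *\<^sub>R axis i 1)))"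
    by simp
  from DERIV_chain2[OF this norm_line_deriv[OF v, of i]]
  have "((\<lambda>s. h (norm (v + s *\<^sub>R axis i 1) *\<^sub>R axis 1 1)) has_field_derivative d * (v $ i / norm v)) (at 0)" .
  moreover have "h (norm w *\<^sub>R axis 1 1) = h w" for w
    by (rule radial_funD[OF rad]) simp
  ultimately show ?thesis by (intro partial_eqI) simp
qed

lemma divergence_scaleR:
  fixes v :: "real^2"
  assumes "\<And>i. ((\<lambda>s. q (v + s *\<^sub>R axis i 1)) has_field_derivative d i) (at 0)"
  shows "divergence (\<lambda>w. q w *\<^sub>R w) v = 2 * q v + (\<Sum>i\<in>UNIV. v $ i * d i)"
proof -
  have "partial i (\<lambda>w. (q w *\<^sub>R w) $ i) v = q v + v $ i * d i" for i
    using DERIV_mult[OF assms partial_deriv_component[of v i i], of i]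
    by (intro partial_eqI) (simp add: mult_ac add_ac)
  then show ?thesis by (simp add: divergence_def sum.distrib)
qed

text \<open>Integrating \<open>\<Delta>h + div(v q)\<close> over a ball gives the radial flux \<open>v\<cdot>\<nabla>h + |v|\<^sup>2 q\<close>
  through its boundary.\<close>

lemma radial_primitive_flux:
  assumes rad: "radial_fun h" "radial_fun q" "radial_fun w" and cw: "continuous_on UNIV w"
    and h1: "\<And>v i. ((\<lambda>s. h (v + s *\<^sub>R axis i 1)) has_field_derivative partial i h v) (at 0)"
    and c1: "\<And>i. continuous_on UNIV (partial i h)"
    and h2: "\<And>v i. ((\<lambda>s. partial i h (v + s *\<^sub>R axis i 1)) has_field_derivative partial i (partial i h) v) (at 0)"
    and cq: "continuous_on UNIV q"
    and q1: "\<And>v i. ((\<lambda>s. q (v + s *\<^sub>R axis i 1)) has_field_derivative dq i v) (at 0)"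
    and w: "\<And>v. w v = laplacian h v + divergence (\<lambda>w. q w *\<^sub>R w) v"
  shows "radial_primitive w v = (\<Sum>i\<in>UNIV. v $ i * partial i h v) + (v \<bullet> v) * q v"
proof (cases "v = 0")
  case False
  let ?e = "axis 1 1 :: real^2"
  define R where "R = norm v"
  have R: "R > 0" using False by (simp add: R_def)
  \<comment> \<open>This is the flux through the circle of radius \<rho>, divided by 2 pi. Writing
    h' for the derivative along the axis, its derivative is \<rho> h'' + h' + 2 \<rho> q + \<rho>^2
    q', which is \<rho> w because the Laplacian is h'' + h' / \<rho> in the plane. The weight \<rho>
    of the primitive is the polar area element that makes this exact.\<close>
  let ?K = "\<lambda>\<rho>. \<rho> * partial 1 h (\<rho> *\<^sub>R ?e) + \<rho>\<^sup>2 * q (\<rho> *\<^sub>R ?e)"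
  have shift: "((\<lambda>\<rho>. k (\<rho> *\<^sub>R ?e)) has_field_derivative d) (at \<rho>)"
    if "((\<lambda>s. k (\<rho> *\<^sub>R ?e + s *\<^sub>R ?e)) has_field_derivative d) (at 0)" for k d \<rho>
    using that DERIV_shift[of "\<lambda>\<rho>. k (\<rho> *\<^sub>R ?e)" d 0 \<rho>]
    by (simp add: scaleR_add_left add.commute)
  \<comment> \<open>The transverse second derivative at a point of the first axis. Along the
    vertical line through it, \<open>partial 2 h\<close> is \<open>G s * s\<close> with
    \<open>G\<close> continuous, so Caratheodory's criterion gives the derivative \<open>G 0\<close>
    without differentiating \<open>G\<close>.\<close>
  have d22: "partial 2 (partial 2 h) (\<rho> *\<^sub>R ?e) = partial 1 h (\<rho> *\<^sub>R ?e) / \<rho>" if \<rho>: "\<rho> > 0" for \<rho>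
  proof (rule partial_eqI)
    let ?p = "\<lambda>s. \<rho> *\<^sub>R ?e + s *\<^sub>R axis 2 1"
    have p1: "?p s $ 1 = \<rho>" for s by (simp add: axis_def)
    then have p0: "?p s \<noteq> 0" for s using \<rho> by (metis less_irrefl zero_index)
    define G where "G s = partial 1 h (norm (?p s) *\<^sub>R ?e) / norm (?p s)" for s
    have pG: "partial 2 h (?p s) = G s * s" for s
      using radial_partial[where i = 2 and v = "?p s", OF rad(1) p0 h1] by (simp add: G_def axis_def)
    have "isCont G 0"
    proof -
      have "continuous_on UNIV G"
        unfolding G_def using p0
        by (intro continuous_intros continuous_on_compose2[OF c1]) auto
      then show ?thesis by (simp add: continuous_on_eq_continuous_at)
    qed
    moreover have "G 0 = partial 1 h (\<rho> *\<^sub>R ?e) / \<rho>" using \<rho> by (simp add: G_def)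
    ultimately show "((\<lambda>s. partial 2 h (?p s)) has_field_derivative partial 1 h (\<rho> *\<^sub>R ?e) / \<rho>) (at 0)"
      unfolding CARAT_DERIV pG by (intro exI[of _ G]) simp
  qed
  \<comment> \<open>The interior form of the fundamental theorem avoids \<rho> = 0, where
    \<open>d22\<close> would divide by zero.\<close>
  have "((\<lambda>\<rho>. \<rho> * w (\<rho> *\<^sub>R ?e)) has_integral ?K R - ?K 0) {0..R}"
  proof (rule fundamental_theorem_of_calculus_interior)
    show "continuous_on {0..R} ?K"
      by (intro continuous_intros continuous_on_compose2[OF c1] continuous_on_compose2[OF cq]) auto
    fix \<rho> assume "\<rho> \<in> {0<..<R}"
    then have \<rho>: "\<rho> > 0" by simp
    have "w (\<rho> *\<^sub>R ?e) = partial 1 (partial 1 h) (\<rho> *\<^sub>R ?e) + partial 1 h (\<rho> *\<^sub>R ?e) / \<rho>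
        + 2 * q (\<rho> *\<^sub>R ?e) + \<rho> * dq 1 (\<rho> *\<^sub>R ?e)"
      unfolding w laplacian_def divergence_scaleR[OF q1] sum_2 d22[OF \<rho>] by (simp add: axis_def)
    then have "\<rho> * w (\<rho> *\<^sub>R ?e) = \<rho> * partial 1 (partial 1 h) (\<rho> *\<^sub>R ?e) + partial 1 h (\<rho> *\<^sub>R ?e)
        + (2 * \<rho> * q (\<rho> *\<^sub>R ?e) + \<rho>\<^sup>2 * dq 1 (\<rho> *\<^sub>R ?e))"
      using \<rho> by (simp add: field_simps power2_eq_square)
    moreover have "((\<lambda>\<rho>. \<rho>\<^sup>2) has_real_derivative 2 * \<rho>) (at \<rho>)"
      by (auto intro!: derivative_eq_intros)
    note DERIV_add[OF DERIV_mult[OF DERIV_ident shift[of "partial 1 h", OF h2]]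
        DERIV_mult[OF this shift[of q, OF q1]]]
    ultimately show "(?K has_vector_derivative \<rho> * w (\<rho> *\<^sub>R ?e)) (at \<rho>)"
      by (simp add: has_real_derivative_iff_has_vector_derivative algebra_simps)
  qed (use R in simp)
  then have "radial_primitive w (R *\<^sub>R ?e) = ?K R"
    using radial_primitive_eqI[of w ?e _ R] R by simp
  moreover have "radial_primitive w (R *\<^sub>R ?e) = radial_primitive w v" "q (R *\<^sub>R ?e) = q v"
    by (auto intro!: radial_funD[OF radial_fun_radial_primitive[OF rad(3)]] radial_funD[OF rad(2)]
        simp: R_def)
  moreover have "(\<Sum>i\<in>UNIV. v $ i * partial i h v) = R * partial 1 h (R *\<^sub>R ?e)"
  proof -
    have "R * R = v $ 1 * v $ 1 + v $ 2 * v $ 2"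
      using dot_square_norm[of v] by (simp add: R_def power2_eq_square inner_vec_def sum_2)
    moreover have "partial i h v = partial 1 h (R *\<^sub>R ?e) * (v $ i / R)" for i
      using radial_partial[OF rad(1) False h1] by (simp add: R_def)
    ultimately have "(\<Sum>i\<in>UNIV. v $ i * partial i h v) = partial 1 h (R *\<^sub>R ?e) * (R * R) / R"
      by (simp add: sum_2 algebra_simps add_divide_distrib)
    then show ?thesis using R by simp
  qed
  moreover have "v \<bullet> v = R\<^sup>2" by (simp add: R_def dot_square_norm)
  ultimately show ?thesis by simp
qed simp

section \<open>The two equations under the transformation\<close>

lemma linear_fokker_planck_eq:
  assumes "\<And>i. ((\<lambda>s. h (v + s *\<^sub>R axis i 1)) has_field_derivative partial i h v) (at 0)"
  shows "linear_fokker_planck h v = laplacian h v + 2 * h v + (\<Sum>i\<in>UNIV. v $ i * partial i h v)"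
  unfolding linear_fokker_planck_def using divergence_scaleR[OF assms] by simp

lemma bose_einstein_flux_deriv:
  assumes "((\<lambda>s. h (v + s *\<^sub>R axis i 1)) has_field_derivative d) (at 0)"
  shows "((\<lambda>s. h (v + s *\<^sub>R axis i 1) * (1 + h (v + s *\<^sub>R axis i 1))) has_field_derivative
      d * (1 + 2 * h v)) (at 0)"
  using DERIV_mult[OF assms DERIV_add[OF DERIV_const assms, of 1]]
  by (simp add: algebra_simps)

lemma bose_einstein_fokker_planck_eq:
  assumes "\<And>i. ((\<lambda>s. h (v + s *\<^sub>R axis i 1)) has_field_derivative partial i h v) (at 0)"
  shows "bose_einstein_fokker_planck h v = laplacian h v + 2 * (h v * (1 + h v))
      + (\<Sum>i\<in>UNIV. v $ i * (partial i h v * (1 + 2 * h v)))"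
  unfolding bose_einstein_fokker_planck_def
  using divergence_scaleR[OF bose_einstein_flux_deriv[OF assms]] by simp

text \<open>Everything follows from the product rule and the identity that the i-th partial of n_f
  is v_i f. What the Bose-Einstein operator does not absorb is exactly f times the flux that
  \<open>radial_primitive_flux\<close> produces for its nonlinearity.\<close>

lemma exp_transform_derivs:
  assumes f: "C1t_C2v f" and rad: "\<And>t. t > 0 \<Longrightarrow> radial_fun (f t)"
    and eq: "\<And>t v. t > 0 \<Longrightarrow> g t v = f t v * exp (radial_primitive (f t) v)" and t: "t > 0"
  shows "time_deriv g t v = exp (radial_primitive (f t) v) *
      (time_deriv f t v + f t v * radial_primitive (time_deriv f t) v)"
    and "partial i (g t) v = exp (radial_primitive (f t) v) * (partial i (f t) v + v $ i * (f t v)\<^sup>2)"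
    and "linear_fokker_planck (g t) v = exp (radial_primitive (f t) v) *
      (bose_einstein_fokker_planck (f t) v
       + f t v * ((\<Sum>i\<in>UNIV. v $ i * partial i (f t) v) + (v \<bullet> v) * (f t v * (1 + f t v))))"
proof -
  let ?E = "\<lambda>v. exp (radial_primitive (f t) v)"
  note df = C1t_C2v_derivs[OF f t] and cf = continuous_pos_time_section[OF C1t_C2v_continuous(1)[OF f] t]
  have g: "C1t_C2v g" by (rule C1t_C2v_exp_transform[OF f rad eq])
  note dg = C1t_C2v_derivs[OF g t]
  have "((\<lambda>s. f s v * exp (radial_primitive (f s) v)) has_field_derivative
      time_deriv f t v * ?E v + ?E v * radial_primitive (time_deriv f t) v * f t v) (at t)"
    by (rule DERIV_mult[OF df(1) DERIV_fun_exp[OF radial_primitive_time_deriv[OF f t]]])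
  then have "((\<lambda>s. g s v) has_field_derivative
      time_deriv f t v * ?E v + ?E v * radial_primitive (time_deriv f t) v * f t v) (at t)"
    by (rule has_field_derivative_transform_within_open[of _ _ _ "{0<..}"]) (use t eq in auto)
  from DERIV_unique[OF dg(1) this] show "time_deriv g t v = ?E v *
      (time_deriv f t v + f t v * radial_primitive (time_deriv f t) v)"
    by (simp add: algebra_simps)
  have gt: "g t = (\<lambda>v. f t v * ?E v)" using eq[OF t] by auto
  have dE: "((\<lambda>s. ?E (v + s *\<^sub>R axis i 1)) has_field_derivative ?E v * (v $ i * f t v)) (at 0)" for i v
    using DERIV_fun_exp[OF radial_primitive_deriv[OF cf rad[OF t], of v i]] by simp
  have pg: "partial i (g t) v = ?E v * (partial i (f t) v + v $ i * (f t v)\<^sup>2)" for i v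
  proof (rule partial_eqI)
    show "((\<lambda>s. g t (v + s *\<^sub>R axis i 1)) has_field_derivative
        ?E v * (partial i (f t) v + v $ i * (f t v)\<^sup>2)) (at 0)"
      unfolding gt using DERIV_mult[OF df(2) dE, of v i v i]
      by (simp add: algebra_simps power2_eq_square)
  qed
  show "partial i (g t) v = ?E v * (partial i (f t) v + v $ i * (f t v)\<^sup>2)" by (rule pg)
  \<comment> \<open>The factor 3 is 2 from differentiating v_i f^2 plus 1 from differentiating the
    exponential.\<close>
  have ppg: "partial i (partial i (g t)) v = ?E v * (partial i (partial i (f t)) v + (f t v)\<^sup>2
      + 3 * (v $ i * f t v * partial i (f t) v) + (v $ i)\<^sup>2 * f t v ^ 3)" for i
  proof (rule partial_eqI)
    have pg': "partial i (g t) = (\<lambda>v. ?E v * (partial i (f t) v + v $ i * (f t v * f t v)))"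
      using pg by (auto simp: power2_eq_square)
    have "((\<lambda>s. ?E (v + s *\<^sub>R axis i 1) * (partial i (f t) (v + s *\<^sub>R axis i 1)
          + (v + s *\<^sub>R axis i 1) $ i * (f t (v + s *\<^sub>R axis i 1) * f t (v + s *\<^sub>R axis i 1))))
      has_field_derivative ?E v * (v $ i * f t v) * (partial i (f t) v + v $ i * (f t v * f t v))
       + (partial i (partial i (f t)) v + (1 * (f t v * f t v)
          + (partial i (f t) v * f t v + partial i (f t) v * f t v) * v $ i)) * ?E v) (at 0)"
      using DERIV_mult[OF dE[of v i] DERIV_add[OF df(3)[of i v i] DERIV_mult[OF partial_deriv_component[of v i i]
            DERIV_mult[OF df(2)[of v i] df(2)[of v i]]]]] by simp
    then show "((\<lambda>s. partial i (g t) (v + s *\<^sub>R axis i 1)) has_field_derivative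
       ?E v * (partial i (partial i (f t)) v + (f t v)\<^sup>2
      + 3 * (v $ i * f t v * partial i (f t) v) + (v $ i)\<^sup>2 * f t v ^ 3)) (at 0)"
      unfolding pg' by (rule DERIV_cong) (simp add: algebra_simps power2_eq_square power3_eq_cube)
  qed
  have vv: "v \<bullet> v = (v $ 1)\<^sup>2 + (v $ 2)\<^sup>2"
    by (simp add: inner_vec_def sum_2 power2_eq_square)
  show "linear_fokker_planck (g t) v = ?E v * (bose_einstein_fokker_planck (f t) v
       + f t v * ((\<Sum>i\<in>UNIV. v $ i * partial i (f t) v) + (v \<bullet> v) * (f t v * (1 + f t v))))"
    unfolding linear_fokker_planck_eq[OF dg(2)] bose_einstein_fokker_planck_eq[OF df(2)]
      laplacian_def sum_2 ppg pg vv
    by (simp add: eq[OF t] algebra_simps power2_eq_square power3_eq_cube)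
qed

lemma radial_fun_time_deriv:
  assumes "\<And>t. t > 0 \<Longrightarrow> radial_fun (u t)" "t > 0"
  shows "radial_fun (time_deriv u t)"
  unfolding radial_fun_def
proof (intro allI impI)
  fix v w :: "real^2" assume *: "norm v = norm w"
  have "\<forall>\<^sub>F s in nhds t. u s v = u s w"
    using eventually_nhds_in_open[of "{0<..}" t] assms(2)
    by (auto elim!: eventually_mono intro: radial_funD[OF assms(1) *])
  then show "time_deriv u t v = time_deriv u t w"
    unfolding time_deriv_def by (rule deriv_cong_ev) simp
qed

lemma pde_equivalence:
  assumes f: "C1t_C2v f" and rad: "\<And>t. t > 0 \<Longrightarrow> radial_fun (f t)" "\<And>t. t > 0 \<Longrightarrow> radial_fun (g t)"
    and g: "\<And>t v. t > 0 \<Longrightarrow> g t v = f t v * exp (radial_primitive (f t) v)"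
    and E: "\<And>t v. t > 0 \<Longrightarrow> exp (radial_primitive (f t) v) = 1 + radial_primitive (g t) v"
  shows "(\<forall>t>0. \<forall>v. time_deriv f t v = bose_einstein_fokker_planck (f t) v) \<longleftrightarrow>
         (\<forall>t>0. \<forall>v. time_deriv g t v = linear_fokker_planck (g t) v)"
proof -
  have gC: "C1t_C2v g" by (rule C1t_C2v_exp_transform[OF f rad(1) g])
  let ?flux = "\<lambda>t v. (\<Sum>i\<in>UNIV. v $ i * partial i (f t) v) + (v \<bullet> v) * (f t v * (1 + f t v))"
  note cf = continuous_pos_time_section[OF C1t_C2v_continuous(1)[OF f]]
    continuous_pos_time_section[OF C1t_C2v_continuous(2)[OF f]]
    continuous_pos_time_section[OF C1t_C2v_continuous(3)[OF f]]
  note cg = continuous_pos_time_section[OF C1t_C2v_continuous(1)[OF gC]]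
    continuous_pos_time_section[OF C1t_C2v_continuous(2)[OF gC]]
    continuous_pos_time_section[OF C1t_C2v_continuous(3)[OF gC]]
  have flux_f: "radial_primitive (time_deriv f t) v = ?flux t v"
    if t: "t > 0" and pde: "\<And>v. time_deriv f t v = bose_einstein_fokker_planck (f t) v" for t v
  proof (rule radial_primitive_flux)
    show "radial_fun (f t)" by (rule rad(1)[OF t])
    then show "radial_fun (\<lambda>v. f t v * (1 + f t v))"
      unfolding radial_fun_def by metis
    show "radial_fun (time_deriv f t)" by (rule radial_fun_time_deriv[OF rad(1) t])
    show "continuous_on UNIV (time_deriv f t)" "continuous_on UNIV (partial i (f t))" for i
      by (rule cf t)+
    show "continuous_on UNIV (\<lambda>v. f t v * (1 + f t v))"
      by (intro continuous_intros cf t)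
    show "time_deriv f t v = laplacian (f t) v + divergence (\<lambda>w. (f t w * (1 + f t w)) *\<^sub>R w) v" for v
      by (simp add: pde bose_einstein_fokker_planck_def)
  qed (rule C1t_C2v_derivs[OF f t] bose_einstein_flux_deriv)+
  have flux_g: "radial_primitive (time_deriv g t) v = (\<Sum>i\<in>UNIV. v $ i * partial i (g t) v) + (v \<bullet> v) * g t v"
    if t: "t > 0" and pde: "\<And>v. time_deriv g t v = linear_fokker_planck (g t) v" for t v
  proof (rule radial_primitive_flux)
    show "radial_fun (g t)" "radial_fun (g t)" by (rule rad(2)[OF t])+
    show "radial_fun (time_deriv g t)" by (rule radial_fun_time_deriv[OF rad(2) t])
    show "continuous_on UNIV (time_deriv g t)" "continuous_on UNIV (partial i (g t))"
      "continuous_on UNIV (g t)" for i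
      by (rule cg t)+
    show "time_deriv g t v = laplacian (g t) v + divergence (\<lambda>w. g t w *\<^sub>R w) v" for v
      by (simp add: pde linear_fokker_planck_def)
  qed (rule C1t_C2v_derivs[OF gC t])+
  \<comment> \<open>Here the equation for \<open>f\<close> is not yet available. The flux identity
    for \<open>g\<close> is carried over by differentiating e^(n_f) = 1 + n_g in time and cancelling
    e^(n_f).\<close>
  have flux_f': "radial_primitive (time_deriv f t) v = ?flux t v"
    if t: "t > 0" and pde: "\<And>v. time_deriv g t v = linear_fokker_planck (g t) v" for t v
  proof -
    let ?E = "exp (radial_primitive (f t) v)"
    have "((\<lambda>s. exp (radial_primitive (f s) v) - 1) has_field_derivative
        ?E * radial_primitive (time_deriv f t) v - 0) (at t)"
      by (intro DERIV_diff DERIV_fun_exp radial_primitive_time_deriv f t DERIV_const)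
    then have "((\<lambda>s. radial_primitive (g s) v) has_field_derivative
        ?E * radial_primitive (time_deriv f t) v - 0) (at t)"
      by (rule has_field_derivative_transform_within_open[of _ _ _ "{0<..}"]) (use t E in auto)
    from DERIV_unique[OF this radial_primitive_time_deriv[OF gC t]]
    have *: "?E * radial_primitive (time_deriv f t) v = (\<Sum>i\<in>UNIV. v $ i * partial i (g t) v) + (v \<bullet> v) * g t v"
      using flux_g[OF that] by simp
    have "partial i (g t) v = ?E * (partial i (f t) v + v $ i * (f t v)\<^sup>2)" for i
      by (rule exp_transform_derivs(2)[OF f rad(1) g t])
    then have "?E * radial_primitive (time_deriv f t) v = ?E * ?flux t v"
      unfolding * g[OF t, of v]
      by (simp add: algebra_simps power2_eq_square inner_vec_def sum_2)
    then show ?thesis by simp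
  qed
  show ?thesis
  proof (intro iffI allI impI)
    fix t :: real and v :: "real^2"
    assume t: "t > 0"
    let ?E = "exp (radial_primitive (f t) v)"
    have d1: "time_deriv g t v = ?E * (time_deriv f t v + f t v * radial_primitive (time_deriv f t) v)"
      by (rule exp_transform_derivs(1)[OF f rad(1) g t])
    have d2: "linear_fokker_planck (g t) v = ?E * (bose_einstein_fokker_planck (f t) v + f t v * ?flux t v)"
      by (rule exp_transform_derivs(3)[OF f rad(1) g t])
    { assume "\<forall>t>0. \<forall>v. time_deriv f t v = bose_einstein_fokker_planck (f t) v"
      with t have pde: "time_deriv f t v = bose_einstein_fokker_planck (f t) v" for v by blast
      show "time_deriv g t v = linear_fokker_planck (g t) v"
        unfolding d1 d2 flux_f[OF t pde] by (simp add: pde) }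
    { assume "\<forall>t>0. \<forall>v. time_deriv g t v = linear_fokker_planck (g t) v"
      with t have pde: "time_deriv g t v = linear_fokker_planck (g t) v" for v by blast
      from pde[of v] show "time_deriv f t v = bose_einstein_fokker_planck (f t) v"
        unfolding d1 d2 flux_f'[OF t pde] by simp }
  qed
qed

section \<open>Radial measures in the plane\<close>

text \<open>Polar coordinates for radial integrands without a change of variables: half-lines
  \<open>{..r}\<close> are a generating class stable under intersection, and the disc area pi r^2
  has derivative 2 pi r.\<close>

lemma distr_lborel_norm:
  "distr (lborel :: (real^2) measure) borel norm = density lborel (\<lambda>s. ennreal (2 * pi * s * indicator {0..} s))"
  (is "?M = ?N")
proof (rule measure_eqI_generator_eq[where E = "range atMost" and \<Omega> = UNIV and A = "\<lambda>i. {..real i}"])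
  show "Int_stable (range (atMost :: real \<Rightarrow> real set))"
    by (auto simp: Int_stable_def)
  have M: "emeasure ?M {..r} = ennreal (if r \<ge> 0 then pi * r\<^sup>2 else 0)" for r
  proof -
    have "norm -` {..r} = (cball 0 r :: (real^2) set)" by auto
    then show ?thesis
      by (simp add: emeasure_distr emeasure_cball unit_ball_vol_2)
  qed
  have N: "emeasure ?N {..r} = ennreal (if r \<ge> 0 then pi * r\<^sup>2 else 0)" for r
  proof -
    have "emeasure ?N {..r} = (\<integral>\<^sup>+s. ennreal (2 * pi * s) * indicator {0..r} s \<partial>lborel)"
      by (subst emeasure_density) (auto intro!: nn_integral_cong split: split_indicator)
    also have "\<dots> = ennreal (if r \<ge> 0 then pi * r\<^sup>2 else 0)"
    proof (cases "r \<ge> 0")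
      case True
      have "(\<integral>\<^sup>+s. ennreal (2 * pi * s) * indicator {0..r} s \<partial>lborel) = pi * r\<^sup>2 - pi * 0\<^sup>2"
        by (rule nn_integral_FTC_Icc) (use True in \<open>auto intro!: derivative_eq_intros\<close>)
      then show ?thesis using True by simp
    qed simp
    finally show ?thesis .
  qed
  show "emeasure ?M X = emeasure ?N X" if "X \<in> range atMost" for X
    using that M N by auto
  show "sets ?M = sigma_sets UNIV (range atMost)" "sets ?N = sigma_sets UNIV (range atMost)"
    by (simp_all add: borel_eq_atMost)
  show "(\<Union>i. {..real i}) = UNIV"
    using real_arch_simple by auto
  show "emeasure ?M {..real i} \<noteq> \<infinity>" for i by (simp add: M)
qed auto

lemma emeasure_radial_density_cball:
  assumes cont: "continuous_on UNIV u" and rad: "radial_fun u" and nonneg: "\<And>v. u v \<ge> 0"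
    and r: "r \<ge> 0" and e: "norm e = 1"
  shows "emeasure (density lborel (\<lambda>v. ennreal (u v))) (cball 0 r) = ennreal (2 * pi * radial_primitive u (r *\<^sub>R e))"
proof -
  have c: "continuous_on UNIV (\<lambda>s. u (s *\<^sub>R e))"
    by (intro continuous_on_compose2[OF cont] continuous_intros) auto
  have [measurable]: "u \<in> borel_measurable borel" "(\<lambda>s. u (s *\<^sub>R e)) \<in> borel_measurable borel"
    using cont c by (auto intro: borel_measurable_continuous_onI)
  have u: "u (norm v *\<^sub>R e) = u v" for v
    by (rule radial_funD[OF rad]) (simp add: e)
  have "emeasure (density lborel (\<lambda>v. ennreal (u v))) (cball 0 r) = (\<integral>\<^sup>+v. ennreal (u v) * indicator (cball 0 r) v \<partial>lborel)"
    by (rule emeasure_density) auto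
  also have "\<dots> = (\<integral>\<^sup>+v. ennreal (u (norm v *\<^sub>R e)) * indicator {..r} (norm v) \<partial>(lborel :: (real^2) measure))"
    by (rule nn_integral_cong) (simp add: u indicator_def)
  also have "\<dots> = (\<integral>\<^sup>+s. ennreal (u (s *\<^sub>R e)) * indicator {..r} s \<partial>distr (lborel :: (real^2) measure) borel norm)"
    by (subst nn_integral_distr) auto
  also have "\<dots> = (\<integral>\<^sup>+s. ennreal (2 * pi * s * indicator {0..} s) * (ennreal (u (s *\<^sub>R e)) * indicator {..r} s) \<partial>lborel)"
    unfolding distr_lborel_norm by (subst nn_integral_density) auto
  also have "\<dots> = (\<integral>\<^sup>+s. ennreal (if s \<in> {0..r} then 2 * pi * (s * u (s *\<^sub>R e)) else 0) \<partial>lborel)"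
    by (rule nn_integral_cong) (auto split: split_indicator simp: ennreal_mult' nonneg mult_ac)
  also have "\<dots> = ennreal (2 * pi * radial_primitive u (r *\<^sub>R e))"
  proof (rule nn_integral_has_integral_lborel)
    show "(\<lambda>s. if s \<in> {0..r} then 2 * pi * (s * u (s *\<^sub>R e)) else 0) \<in> borel_measurable borel"
      by measurable
    show "0 \<le> (if s \<in> {0..r} then 2 * pi * (s * u (s *\<^sub>R e)) else 0)" for s
      using nonneg by simp
    show "((\<lambda>s. if s \<in> {0..r} then 2 * pi * (s * u (s *\<^sub>R e)) else 0) has_integral
        2 * pi * radial_primitive u (r *\<^sub>R e)) UNIV"
      unfolding has_integral_restrict_UNIV
      by (intro has_integral_mult_right radial_primitive_has_integral cont rad r e)
  qed
  finally show ?thesis .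
qed

lemma borel_measurable_orthogonal:
  fixes T :: "real^2 \<Rightarrow> real^2"
  assumes "orthogonal_transformation T"
  shows "T \<in> borel_measurable borel"
  using orthogonal_transformation_linear[OF assms]
  by (intro borel_measurable_continuous_onI linear_continuous_on) (simp add: linear_conv_bounded_linear)

text \<open>Lebesgue measure is determined by its values on boxes, and the preimage of a box is its
  image under the inverse, which is again orthogonal.\<close>

lemma distr_lborel_orthogonal:
  fixes T :: "real^2 \<Rightarrow> real^2"
  assumes T: "orthogonal_transformation T"
  shows "distr lborel borel T = lborel"
proof (rule lborel_eqI[symmetric])
  fix l u :: "real^2"
  assume lu: "\<And>b. b \<in> Basis \<Longrightarrow> l \<bullet> b \<le> u \<bullet> b"
  have [measurable]: "T \<in> borel_measurable borel" by (rule borel_measurable_orthogonal[OF T])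
  have b: "bij T" by (rule orthogonal_transformation_bij[OF T])
  have o: "orthogonal_transformation (inv T)" by (rule orthogonal_transformation_inv[OF T])
  have im: "T -` box l u = inv T ` box l u"
    using b by (simp add: bij_vimage_eq_inv_image)
  have m: "T -` box l u \<in> sets borel"
    using measurable_sets[of T borel borel "box l u"] by simp
  have lm: "box l u \<in> lmeasurable" by simp
  have "emeasure (distr lborel borel T) (box l u) = emeasure lebesgue (T -` box l u)"
    using m by (simp add: emeasure_distr emeasure_completion)
  also have "\<dots> = ennreal (measure lebesgue (inv T ` box l u))"
    unfolding im by (rule emeasure_eq_measure2) (rule measurable_orthogonal_image[OF o lm])
  also have "\<dots> = ennreal (measure lborel (box l u))"
    using measure_orthogonal_image[OF o lm] by simp
  also have "\<dots> = ennreal (\<Prod>b\<in>Basis. (u - l) \<bullet> b)"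
    using lu by (simp add: measure_lborel_box_eq)
  finally show "emeasure (distr lborel borel T) (box l u) = ennreal (\<Prod>b\<in>Basis. (u - l) \<bullet> b)" .
qed simp

lemma radial_measure_density:
  assumes [measurable]: "u \<in> borel_measurable borel" and rad: "radial_fun u"
  shows "radial_measure (density lborel (\<lambda>v. ennreal (u v)))"
  unfolding radial_measure_def
proof (intro allI impI)
  fix T :: "real^2 \<Rightarrow> real^2" assume T: "orthogonal_transformation T"
  have [measurable]: "T \<in> borel_measurable borel" by (rule borel_measurable_orthogonal[OF T])
  have "u (T v) = u v" for v
    by (rule radial_funD[OF rad]) (simp add: orthogonal_transformation_norm[OF T])
  then have "distr (density lborel (\<lambda>v. ennreal (u v))) borel T = distr (density lborel (\<lambda>v. ennreal (u (T v)))) borel T"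
    by simp
  also have "\<dots> = density (distr lborel borel T) (\<lambda>v. ennreal (u v))"
    by (rule density_distr[symmetric]) auto
  finally show "distr (density lborel (\<lambda>v. ennreal (u v))) borel T = density lborel (\<lambda>v. ennreal (u v))"
    by (simp add: distr_lborel_orthogonal[OF T])
qed

section \<open>Weak-* convergence of finite measures\<close>

text \<open>Sequences replace the filter \<open>at_right 0\<close> so that dominated convergence and
  the boundedness argument apply.\<close>

definition converges_on_C0 :: "(nat \<Rightarrow> (real^2) measure) \<Rightarrow> (real^2) measure \<Rightarrow> bool" where
  "converges_on_C0 M N \<longleftrightarrow> (\<forall>h :: real^2 \<Rightarrow> real. continuous_on UNIV h \<and> (h \<longlongrightarrow> 0) at_infinity \<longrightarrow>
     (\<lambda>k. \<integral>v. h v \<partial>M k) \<longlonglongrightarrow> (\<integral>v. h v \<partial>N))"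

definition finite_borel :: "(real^2) measure \<Rightarrow> bool" where
  "finite_borel M \<longleftrightarrow> sets M = sets borel \<and> finite_measure M"

lemma finite_borel_sets: "finite_borel M \<Longrightarrow> sets M = sets borel"
  and finite_borel_finite: "finite_borel M \<Longrightarrow> finite_measure M"
  by (auto simp: finite_borel_def)

lemma C0_bounded:
  fixes h :: "real^2 \<Rightarrow> real"
  assumes "continuous_on UNIV h" "(h \<longlongrightarrow> 0) at_infinity"
  obtains B where "\<And>v. \<bar>h v\<bar> \<le> B"
proof -
  have "\<forall>\<^sub>F v in at_infinity. \<bar>h v\<bar> < 1"
    using tendstoD[OF assms(2), of 1] by simp
  then obtain R where R: "\<And>v. norm v \<ge> R \<Longrightarrow> \<bar>h v\<bar> < 1"
    by (auto simp: eventually_at_infinity)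
  have "compact (h ` cball 0 R)"
    by (intro compact_continuous_image continuous_on_subset[OF assms(1)]) auto
  then obtain B where B: "\<And>v. v \<in> cball 0 R \<Longrightarrow> \<bar>h v\<bar> \<le> B"
    using compact_imp_bounded bounded_iff by (metis imageI real_norm_def)
  have "\<bar>h v\<bar> \<le> max B 1" for v
    using R[of v] B[of v] by (cases "norm v \<le> R") auto
  then show ?thesis by (rule that)
qed

lemma integrable_bounded:
  assumes M: "finite_borel M" and "h \<in> borel_measurable borel" "\<And>v. \<bar>h v\<bar> \<le> B"
  shows "integrable M (h :: _ \<Rightarrow> real)"
proof -
  have "h \<in> borel_measurable M"
    using assms(2) measurable_cong_sets[OF finite_borel_sets[OF M] refl] by blast
  then show ?thesis
    using assms(3) by (intro finite_measure.integrable_const_bound[OF finite_borel_finite[OF M], of _ B]) auto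
qed

lemma integrable_C0:
  assumes "finite_borel M" "continuous_on UNIV h" "(h \<longlongrightarrow> 0) at_infinity"
  shows "integrable M (h :: _ \<Rightarrow> real)"
  using C0_bounded[OF assms(2,3)] integrable_bounded[OF assms(1) borel_measurable_continuous_onI[OF assms(2)]]
  by metis

text \<open>For \<open>a < b\<close> a continuous function lying between the indicators of the
  closed balls of radii \<open>a\<close> and \<open>b\<close>.\<close>

definition cutoff :: "real \<Rightarrow> real \<Rightarrow> real^2 \<Rightarrow> real" where
  "cutoff a b v = max 0 (min 1 ((b - norm v) / (b - a)))"

lemma cutoff_range: "0 \<le> cutoff a b v" "cutoff a b v \<le> 1"
  by (auto simp: cutoff_def)

lemma continuous_cutoff: "continuous_on UNIV (cutoff a b)"
  unfolding cutoff_def[abs_def] divide_inverse by (intro continuous_intros)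

lemma cutoff_vanishes:
  assumes "a < b"
  shows "(cutoff a b \<longlongrightarrow> 0) at_infinity"
proof (rule tendsto_eventually)
  show "\<forall>\<^sub>F v in at_infinity. cutoff a b v = 0"
    unfolding eventually_at_infinity cutoff_def
    using assms by (intro exI[of _ b]) (auto simp: divide_nonpos_pos)
qed

lemma integral_cutoff_bounds:
  assumes M: "finite_borel M" and ab: "a < b"
  shows "measure M (cball 0 a) \<le> (\<integral>v. cutoff a b v \<partial>M)"
    and "(\<integral>v. cutoff a b v \<partial>M) \<le> measure M (cball 0 b)"
proof -
  interpret finite_measure M by (rule finite_borel_finite[OF M])
  have [measurable]: "cball 0 r \<in> sets M" for r :: real
    by (simp add: finite_borel_sets[OF M])
  have i: "integrable M (cutoff a b)"
    by (rule integrable_C0[OF M continuous_cutoff cutoff_vanishes[OF ab]])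
  have ind: "integrable M (indicator (cball 0 r) :: _ \<Rightarrow> real)" for r :: real
    by (simp add: integrable_indicator_iff less_top[symmetric])
  have m: "(\<integral>v. indicator (cball 0 r) v \<partial>M) = measure M (cball 0 r)" for r :: real
    by (simp add: integral_indicator)
  have "indicator (cball 0 a) v \<le> cutoff a b v" for v
    using ab cutoff_range[of a b v] by (auto simp: cutoff_def split: split_indicator)
  then show "measure M (cball 0 a) \<le> (\<integral>v. cutoff a b v \<partial>M)"
    unfolding m[symmetric] by (intro integral_mono ind i)
  have "cutoff a b v \<le> indicator (cball 0 b) v" for v
    using ab cutoff_range[of a b v] by (auto simp: cutoff_def divide_nonpos_pos split: split_indicator)
  then show "(\<integral>v. cutoff a b v \<partial>M) \<le> measure M (cball 0 b)"
    unfolding m[symmetric] by (intro integral_mono ind i)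
qed

lemma measure_cball_mono:
  assumes "finite_borel M"
  shows "mono (\<lambda>r. measure M (cball 0 r))"
  by (auto intro!: monoI finite_measure.finite_measure_mono[OF finite_borel_finite[OF assms]]
      simp: finite_borel_sets[OF assms])

lemma measure_cball_le_UNIV:
  assumes "finite_borel M"
  shows "measure M (cball 0 r) \<le> measure M UNIV"
  by (auto intro!: finite_measure.finite_measure_mono[OF finite_borel_finite[OF assms]]
      simp: finite_borel_sets[OF assms])

lemma measure_cball_tendsto:
  assumes "finite_borel M"
  shows "(\<lambda>n. measure M (cball 0 (real n))) \<longlonglongrightarrow> measure M UNIV"
proof -
  interpret finite_measure M by (rule finite_borel_finite[OF assms])
  have "(\<lambda>n. measure M (cball 0 (real n))) \<longlonglongrightarrow> measure M (\<Union>n. cball 0 (real n))"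
    by (rule finite_Lim_measure_incseq) (auto simp: finite_borel_sets[OF assms] incseq_def)
  moreover have "(\<Union>n. cball 0 (real n)) = (UNIV :: (real^2) set)"
    using real_arch_simple by auto
  ultimately show ?thesis by simp
qed

lemma measure_UNIV_le:
  assumes "finite_borel M" "\<And>r. r \<ge> 0 \<Longrightarrow> measure M (cball 0 r) \<le> C"
  shows "measure M UNIV \<le> C"
  by (rule LIMSEQ_le_const2[OF measure_cball_tendsto[OF assms(1)]]) (use assms(2) in auto)

text \<open>If the masses were unbounded, a lacunary sum of cutoffs would be a function in \<open>C\<^sub>0\<close>
  with unbounded integrals.\<close>

lemma converges_on_C0_bounded_mass:
  assumes M: "\<And>k. finite_borel (M k)" and conv: "converges_on_C0 M N"
  obtains C where "\<And>k. measure (M k) UNIV \<le> C"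
proof (rule ccontr)
  assume "\<not> thesis"
  with that have unb: "\<not> (\<forall>k. measure (M k) UNIV \<le> C)" for C by blast
  \<comment> \<open>Large total mass is already visible in a ball, where a cutoff can detect
    it.\<close>
  have "\<exists>k R. measure (M k) (cball 0 R) > 4 ^ j" for j :: nat
  proof (rule ccontr)
    assume "\<not> ?thesis"
    then have "measure (M k) UNIV \<le> 4 ^ j" for k
      by (intro measure_UNIV_le[OF M]) (meson not_le)
    then show False using unb by blast
  qed
  then obtain \<kappa> R where \<kappa>: "measure (M (\<kappa> j)) (cball 0 (R j)) > 4 ^ j" for j
    by metis
  \<comment> \<open>The weights 2^(-j) make the series converge uniformly, yet against masses 4^j
    they leave 2^j.\<close>
  define f where "f j v = (1/2) ^ j * cutoff (R j) (R j + 1) v" for j v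
  define h where "h v = (\<Sum>j. f j v)" for v
  have f: "norm (f j v) \<le> (1/2) ^ j" for j v
    using cutoff_range[of "R j" "R j + 1" v] by (simp add: f_def mult_left_le)
  have f0: "f j v \<ge> 0" for j v
    using cutoff_range[of "R j" "R j + 1" v] by (simp add: f_def)
  have sf: "summable (\<lambda>j. f j v)" for v
    by (rule summable_comparison_test[OF _ summable_geometric[of "1/2"]]) (use f in auto)
  have ul: "uniform_limit UNIV (\<lambda>n v. \<Sum>j<n. f j v) h sequentially"
    unfolding h_def by (rule Weierstrass_m_test[where M = "\<lambda>j. (1/2) ^ j"])
      (use f in \<open>auto intro: summable_geometric\<close>)
  have cf: "continuous_on UNIV (f j)" for j
    unfolding f_def by (intro continuous_intros continuous_cutoff)
  have zf: "(f j \<longlongrightarrow> 0) at_infinity" for j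
    unfolding f_def by (rule tendsto_mult_right_zero) (rule cutoff_vanishes, simp)
  have ch: "continuous_on UNIV h"
    by (rule uniform_limit_theorem[OF _ ul]) (auto intro!: always_eventually continuous_on_sum cf)
  have zh: "(h \<longlongrightarrow> 0) at_infinity"
    by (rule swap_uniform_limit'[OF _ tendsto_const ul])
       (auto intro!: always_eventually tendsto_null_sum zf)
  have "(\<lambda>k. \<integral>v. h v \<partial>M k) \<longlonglongrightarrow> (\<integral>v. h v \<partial>N)"
    using conv ch zh by (auto simp: converges_on_C0_def)
  then have "Bseq (\<lambda>k. \<integral>v. h v \<partial>M k)"
    by (intro convergent_imp_Bseq convergentI)
  then obtain K where K: "\<And>k. norm (\<integral>v. h v \<partial>M k) \<le> K"
    by (auto simp: Bseq_def)
  have "2 ^ j \<le> K" for j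
  proof -
    have "(2::real) ^ j = (1/2) ^ j * 4 ^ j"
      by (simp flip: power_mult_distrib)
    also have "\<dots> \<le> (1/2) ^ j * (\<integral>v. cutoff (R j) (R j + 1) v \<partial>M (\<kappa> j))"
      using integral_cutoff_bounds(1)[OF M, of "R j" "R j + 1" "\<kappa> j"] \<kappa>[of j]
      by (intro mult_left_mono) auto
    also have "\<dots> = (\<integral>v. f j v \<partial>M (\<kappa> j))" by (simp add: f_def)
    also have "\<dots> \<le> (\<integral>v. h v \<partial>M (\<kappa> j))"
    proof (rule integral_mono)
      show "f j v \<le> h v" for v
        using sum_le_suminf[OF sf[of v], of "{j}"] f0 by (simp add: h_def)
    qed (rule integrable_C0 M cf zf ch zh)+
    also have "\<dots> \<le> K" using K[of "\<kappa> j"] by simp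
    finally show ?thesis .
  qed
  moreover obtain j where "K < 2 ^ j" using real_arch_pow[of 2 K] by auto
  ultimately show False by (metis not_le)
qed

text \<open>The portmanteau argument for balls: cutoffs with slightly smaller or larger radius bound
  the ball mass from below and above, and continuity at \<open>r\<close> closes the gap.\<close>

lemma converges_on_C0_cball:
  assumes M: "\<And>k. finite_borel (M k)" and N: "finite_borel N" and conv: "converges_on_C0 M N"
    and cont: "isCont (\<lambda>R. measure N (cball 0 R)) r"
  shows "(\<lambda>k. measure (M k) (cball 0 r)) \<longlonglongrightarrow> measure N (cball 0 r)"
proof (rule order_tendstoI)
  have lim: "(\<lambda>k. \<integral>v. cutoff a b v \<partial>M k) \<longlonglongrightarrow> (\<integral>v. cutoff a b v \<partial>N)" if "a < b" for a b
    using conv continuous_cutoff cutoff_vanishes[OF that] by (auto simp: converges_on_C0_def)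
  let ?m = "\<lambda>R. measure N (cball 0 R)"
  fix y
  { assume "y < ?m r"
    then have "\<forall>\<^sub>F R in at r. y < ?m R"
      using cont order_tendstoD(1) by (auto simp: isCont_def)
    then have "\<forall>\<^sub>F R in at_left r. y < ?m R" by (simp add: eventually_at_split)
    then obtain b where b: "b < r" "y < ?m b"
      unfolding eventually_at_left_field by (metis dense)
    have "y < (\<integral>v. cutoff b r v \<partial>N)"
      using b(2) integral_cutoff_bounds(1)[OF N b(1)] by simp
    then have "\<forall>\<^sub>F k in sequentially. y < (\<integral>v. cutoff b r v \<partial>M k)"
      by (rule order_tendstoD(1)[OF lim[OF b(1)]])
    then show "\<forall>\<^sub>F k in sequentially. y < measure (M k) (cball 0 r)"
      by eventually_elim (use integral_cutoff_bounds(2)[OF M b(1)] in \<open>meson less_le_trans\<close>) }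
  { assume "?m r < y"
    then have "\<forall>\<^sub>F R in at r. ?m R < y"
      using cont order_tendstoD(2) by (auto simp: isCont_def)
    then have "\<forall>\<^sub>F R in at_right r. ?m R < y" by (simp add: eventually_at_split)
    then obtain b where b: "r < b" "?m b < y"
      unfolding eventually_at_right_field by (metis dense)
    have "(\<integral>v. cutoff r b v \<partial>N) < y"
      using b(2) integral_cutoff_bounds(2)[OF N b(1)] by simp
    then have "\<forall>\<^sub>F k in sequentially. (\<integral>v. cutoff r b v \<partial>M k) < y"
      by (rule order_tendstoD(2)[OF lim[OF b(1)]])
    then show "\<forall>\<^sub>F k in sequentially. measure (M k) (cball 0 r) < y"
      by eventually_elim (use integral_cutoff_bounds(1)[OF M b(1)] in \<open>meson le_less_trans\<close>) }
qed

section \<open>Recovering radial integrals from ball masses\<close>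

text \<open>Write e^(-p|v|) as the integral of p e^(-pr) over r >= |v| and apply Tonelli. Negative
  \<open>r\<close> contribute nothing, since those balls are empty.\<close>

lemma integral_exp_norm:
  assumes M: "finite_borel M" and p: "p > 0"
  shows "(\<integral>v. exp (- p * norm v) \<partial>M) = (\<integral>r. p * exp (- p * r) * measure M (cball 0 r) \<partial>lborel)"
proof -
  interpret M: finite_measure M by (rule finite_borel_finite[OF M])
  interpret pair_sigma_finite M lborel
    by (intro pair_sigma_finite.intro M.sigma_finite_measure_axioms sigma_finite_lborel)
  note [measurable_cong] = finite_borel_sets[OF M]
  have [measurable]: "(\<lambda>r. measure M (cball 0 r)) \<in> borel_measurable borel"
    by (rule borel_measurable_mono[OF measure_cball_mono[OF M]])
  have exp: "ennreal (exp (- p * x)) = (\<integral>\<^sup>+r. ennreal (p * exp (- p * r)) * indicator {x..} r \<partial>lborel)" for x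
  proof -
    have "((\<lambda>r. - exp (- p * r)) \<longlongrightarrow> - 0) at_top"
    proof (intro tendsto_minus filterlim_compose[OF exp_at_bot])
      show "LIM r at_top. - p * r :> at_bot"
        using p by (intro filterlim_tendsto_neg_mult_at_bot[OF tendsto_const] filterlim_ident) auto
    qed
    then have "(\<integral>\<^sup>+r. ennreal (p * exp (- p * r)) * indicator {x..} r \<partial>lborel) = ennreal (- 0 - - exp (- p * x))"
      using p by (intro nn_integral_FTC_atLeast) (auto intro!: derivative_eq_intros)
    then show ?thesis by simp
  qed
  \<comment> \<open>The indicator is taken of \<open>r - norm v\<close>, which makes joint
    measurability immediate.\<close>
  have "(\<integral>\<^sup>+v. ennreal (exp (- p * norm v)) \<partial>M)
      = (\<integral>\<^sup>+v. \<integral>\<^sup>+r. ennreal (p * exp (- p * r)) * indicator {0..} (r - norm v) \<partial>lborel \<partial>M)"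
    unfolding exp by (intro nn_integral_cong) (auto split: split_indicator)
  also have "\<dots> = (\<integral>\<^sup>+r. \<integral>\<^sup>+v. ennreal (p * exp (- p * r)) * indicator {0..} (r - norm v) \<partial>M \<partial>lborel)"
  proof -
    have "(\<lambda>(v, r). ennreal (p * exp (- p * r)) * indicator {0..} (r - norm v)) \<in> borel_measurable (M \<Otimes>\<^sub>M lborel)"
      by measurable
    from Fubini'[OF this] show ?thesis by (simp only: case_prod_conv)
  qed
  also have "\<dots> = (\<integral>\<^sup>+r. ennreal (p * exp (- p * r) * measure M (cball 0 r)) \<partial>lborel)"
  proof (rule nn_integral_cong)
    fix r :: real
    have "(\<integral>\<^sup>+v. ennreal (p * exp (- p * r)) * indicator {0..} (r - norm v) \<partial>M)
        = (\<integral>\<^sup>+v. ennreal (p * exp (- p * r)) * indicator (cball 0 r) v \<partial>M)"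
      by (intro nn_integral_cong) (auto split: split_indicator)
    also have "\<dots> = ennreal (p * exp (- p * r)) * emeasure M (cball 0 r)"
      by (rule nn_integral_cmult_indicator) simp
    also have "\<dots> = ennreal (p * exp (- p * r) * measure M (cball 0 r))"
      using p by (simp add: M.emeasure_eq_measure ennreal_mult'')
    finally show "(\<integral>\<^sup>+v. ennreal (p * exp (- p * r)) * indicator {0..} (r - norm v) \<partial>M)
        = ennreal (p * exp (- p * r) * measure M (cball 0 r))" .
  qed
  finally show ?thesis
    using p by (simp add: integral_eq_nn_integral)
qed

lemma integral_exp_norm_tendsto:
  assumes M: "\<And>k. finite_borel (M k)" and N: "finite_borel N"
    and C: "\<And>k. measure (M k) UNIV \<le> C"
    and ae: "AE r in lborel. (\<lambda>k. measure (M k) (cball 0 r)) \<longlonglongrightarrow> measure N (cball 0 r)"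
    and p: "p > 0"
  shows "(\<lambda>k. \<integral>v. exp (- p * norm v) \<partial>M k) \<longlonglongrightarrow> (\<integral>v. exp (- p * norm v) \<partial>N)"
  unfolding integral_exp_norm[OF M p] integral_exp_norm[OF N p]
proof (rule integral_dominated_convergence)
  have [measurable]: "(\<lambda>r. measure L (cball 0 r)) \<in> borel_measurable borel" if "finite_borel L" for L
    by (rule borel_measurable_mono[OF measure_cball_mono[OF that]])
  note [measurable] = M N
  show "(\<lambda>r. p * exp (- p * r) * measure N (cball 0 r)) \<in> borel_measurable lborel"
    "(\<lambda>r. p * exp (- p * r) * measure (M k) (cball 0 r)) \<in> borel_measurable lborel" for k
    by measurable
  show "AE r in lborel. (\<lambda>k. p * exp (- p * r) * measure (M k) (cball 0 r))
      \<longlonglongrightarrow> p * exp (- p * r) * measure N (cball 0 r)"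
    using ae by eventually_elim (intro tendsto_intros)
  \<comment> \<open>The dominating function must be cut at 0, as e^(-pr) is not integrable on the
    whole line.\<close>
  show "integrable lborel (\<lambda>r. C * (p * exp (- p * r) * indicator {0..} r))"
  proof (rule integrable_mult_right, rule integrableI_nonneg)
    have "((\<lambda>r. - exp (- p * r)) \<longlongrightarrow> - 0) at_top"
    proof (intro tendsto_minus filterlim_compose[OF exp_at_bot])
      show "LIM r at_top. - p * r :> at_bot"
        using p by (intro filterlim_tendsto_neg_mult_at_bot[OF tendsto_const] filterlim_ident) auto
    qed
    then have "(\<integral>\<^sup>+r. ennreal (p * exp (- p * r)) * indicator {0..} r \<partial>lborel) = ennreal (- 0 - - exp (- p * 0))"
      using p by (intro nn_integral_FTC_atLeast) (auto intro!: derivative_eq_intros)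
    moreover have "(\<integral>\<^sup>+r. ennreal (p * exp (- p * r) * indicator {0..} r) \<partial>lborel)
        = (\<integral>\<^sup>+r. ennreal (p * exp (- p * r)) * indicator {0..} r \<partial>lborel)"
      by (intro nn_integral_cong) (auto split: split_indicator)
    ultimately show "(\<integral>\<^sup>+r. ennreal (p * exp (- p * r) * indicator {0..} r) \<partial>lborel) < \<infinity>"
      by simp
  qed (use p in \<open>auto intro!: AE_I2\<close>)
  show "AE r in lborel. norm (p * exp (- p * r) * measure (M k) (cball 0 r))
      \<le> C * (p * exp (- p * r) * indicator {0..} r)" for k
  proof (rule AE_I2)
    fix r :: real
    have "measure (M k) (cball 0 r) \<le> C"
      using measure_cball_le_UNIV[OF M, of k r] C[of k] by simp
    then show "norm (p * exp (- p * r) * measure (M k) (cball 0 r))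
      \<le> C * (p * exp (- p * r) * indicator {0..} r)"
      using p by (auto split: split_indicator simp: abs_mult mult_ac intro!: mult_left_mono)
  qed
qed

text \<open>By the Weierstrass theorem in the variable \<open>e\<^bsup>-|v|\<^esup>\<close> the exponentials determine all
  radial functions vanishing at infinity.\<close>

lemma integral_profile_tendsto:
  fixes G :: "real \<Rightarrow> real"
  assumes M: "\<And>k. finite_borel (M k)" and N: "finite_borel N"
    and C: "\<And>k. measure (M k) UNIV \<le> C" "measure N UNIV \<le> C"
    and ae: "AE r in lborel. (\<lambda>k. measure (M k) (cball 0 r)) \<longlonglongrightarrow> measure N (cball 0 r)"
    and G: "continuous_on {0..1} G" "G 0 = 0"
  shows "(\<lambda>k. \<integral>v. G (exp (- norm v)) \<partial>M k) \<longlonglongrightarrow> (\<integral>v. G (exp (- norm v)) \<partial>N)"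
proof (rule LIMSEQ_I)
  fix \<epsilon> :: real assume \<epsilon>: "\<epsilon> > 0"
  have C0: "C \<ge> 0" using C(2) measure_nonneg[of N UNIV] by linarith
  \<comment> \<open>Replacing \<open>G\<close> by \<open>q\<close> costs 2 \<delta> pointwise, hence
    at most 2 \<delta> C in each integral, and this must be at most \<epsilon> / 3. The 1 in the
    denominator covers C = 0.\<close>
  define \<delta> where "\<delta> = \<epsilon> / (6 * (C + 1))"
  have \<delta>: "\<delta> > 0" using \<epsilon> C0 by (simp add: \<delta>_def)
  have "2 * \<delta> * C \<le> \<epsilon> / 3 * (C / (C + 1))" using C0 by (simp add: \<delta>_def field_simps)
  also have "\<dots> \<le> \<epsilon> / 3 * 1"
    using C0 \<epsilon> by (intro mult_left_mono) auto
  finally have \<delta>C: "2 * \<delta> * C \<le> \<epsilon> / 3" by simp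
  obtain g where g: "real_polynomial_function g" "\<And>x. x \<in> {0..1} \<Longrightarrow> \<bar>G x - g x\<bar> < \<delta>"
    using Stone_Weierstrass_real_polynomial_function[OF compact_Icc G(1) \<delta>] by blast
  obtain a n where an: "g = (\<lambda>x. \<Sum>i\<le>n. a i * x ^ i)"
    using g(1) by (auto simp: real_polynomial_function_iff_sum)
  \<comment> \<open>The constant term is dropped because total masses need not converge. As
    \<open>G 0 = 0\<close>, it is smaller than \<delta>.\<close>
  define q where "q x = (\<Sum>i\<in>{1..n}. a i * x ^ i)" for x :: real
  have gq: "g x = a 0 + q x" for x
  proof -
    have "{..n} = insert 0 {1..n}" by auto
    then show ?thesis by (simp add: an q_def)
  qed
  have Gq: "\<bar>G x - q x\<bar> \<le> 2 * \<delta>" if "x \<in> {0..1}" for x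
  proof -
    have "q 0 = 0" by (simp add: q_def)
    then have "\<bar>a 0\<bar> < \<delta>" using g(2)[of 0] G(2) by (simp add: gq)
    then show ?thesis using g(2)[OF that] by (simp add: gq)
  qed
  let ?e = "\<lambda>v :: real^2. exp (- norm v)"
  have e: "?e v \<in> {0..1}" for v by simp
  have cG: "continuous_on UNIV (\<lambda>v. G (?e v))"
    by (rule continuous_on_compose2[OF G(1)]) (auto intro!: continuous_intros)
  have cq: "continuous_on UNIV (\<lambda>v. q (?e v))"
    unfolding q_def by (intro continuous_intros)
  obtain B where B: "\<And>x. x \<in> {0..1} \<Longrightarrow> \<bar>G x\<bar> \<le> B"
    using compact_imp_bounded[OF compact_continuous_image[OF G(1) compact_Icc]]
    unfolding bounded_iff by (metis imageI real_norm_def)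
  have iG: "integrable L (\<lambda>v. G (?e v))" if "finite_borel L" for L
    by (rule integrable_bounded[OF that borel_measurable_continuous_onI[OF cG], of B]) (use B in auto)
  have ie: "integrable L (\<lambda>v. a i * ?e v ^ i)" if "finite_borel L" for L i
    by (rule integrable_bounded[OF that borel_measurable_continuous_onI, of _ "\<bar>a i\<bar>"])
       (auto intro!: continuous_intros simp: abs_mult power_le_one mult_left_le)
  have iq: "integrable L (\<lambda>v. q (?e v))" if "finite_borel L" for L
    unfolding q_def by (intro Bochner_Integration.integrable_sum ie that)
  have err: "\<bar>(\<integral>v. G (?e v) \<partial>L) - (\<integral>v. q (?e v) \<partial>L)\<bar> \<le> \<epsilon> / 3"
    if L: "finite_borel L" and "measure L UNIV \<le> C" for L
  proof -
    interpret finite_measure L by (rule finite_borel_finite[OF L])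
    have sp: "space L = UNIV" using finite_borel_sets[OF L] sets_eq_imp_space_eq by fastforce
    have "\<bar>(\<integral>v. G (?e v) \<partial>L) - (\<integral>v. q (?e v) \<partial>L)\<bar> = \<bar>\<integral>v. G (?e v) - q (?e v) \<partial>L\<bar>"
      by (simp add: iG iq L)
    also have "\<dots> \<le> (\<integral>v. \<bar>G (?e v) - q (?e v)\<bar> \<partial>L)" by (rule integral_abs_bound)
    also have "\<dots> \<le> (\<integral>v. 2 * \<delta> \<partial>L)"
      by (rule integral_mono) (use Gq e in \<open>auto intro!: integrable_abs iG iq L\<close>)
    also have "\<dots> = 2 * \<delta> * measure L UNIV" by (simp add: sp mult_ac)
    also have "\<dots> \<le> 2 * \<delta> * C" using that \<delta> by (intro mult_left_mono) auto
    finally show ?thesis using \<delta>C by linarith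
  qed
  have qsum: "(\<integral>v. q (?e v) \<partial>L) = (\<Sum>i\<in>{1..n}. a i * (\<integral>v. exp (- real i * norm v) \<partial>L))"
    if L: "finite_borel L" for L
  proof -
    have "(\<integral>v. q (?e v) \<partial>L) = (\<Sum>i\<in>{1..n}. \<integral>v. a i * ?e v ^ i \<partial>L)"
      unfolding q_def by (rule Bochner_Integration.integral_sum[OF ie[OF L]])
    moreover have "?e v ^ i = exp (- real i * norm v)" for v i
      by (simp flip: exp_of_nat_mult)
    ultimately show ?thesis by simp
  qed
  have "(\<lambda>k. \<integral>v. q (?e v) \<partial>M k) \<longlonglongrightarrow> (\<integral>v. q (?e v) \<partial>N)"
    unfolding qsum[OF M] qsum[OF N]
    by (intro tendsto_sum tendsto_mult tendsto_const integral_exp_norm_tendsto[OF M N C(1) ae]) auto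
  then have "\<forall>\<^sub>F k in sequentially. dist (\<integral>v. q (?e v) \<partial>M k) (\<integral>v. q (?e v) \<partial>N) < \<epsilon> / 3"
    by (rule tendstoD) (use \<epsilon> in simp)
  then have "\<forall>\<^sub>F k in sequentially. norm ((\<integral>v. G (?e v) \<partial>M k) - (\<integral>v. G (?e v) \<partial>N)) < \<epsilon>"
  proof eventually_elim
    case (elim k)
    then show ?case using err[OF M C(1), of k] err[OF N C(2)] unfolding dist_real_def real_norm_def by linarith
  qed
  then show "\<exists>no. \<forall>k\<ge>no. norm ((\<integral>v. G (?e v) \<partial>M k) - (\<integral>v. G (?e v) \<partial>N)) < \<epsilon>"
    by (simp add: eventually_sequentially)
qed

section \<open>Circular means\<close>

text \<open>A substitute for arc length on the circle: the direction \<open>sgn w\<close> of a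
  uniform point of the disc is uniformly distributed.\<close>

definition disc_uniform :: "(real^2) measure" where
  "disc_uniform = density lborel (\<lambda>v. ennreal (indicator (cball 0 1) v / pi))"

lemma disc_uniform:
  shows sets_disc_uniform: "sets disc_uniform = sets borel"
    and emeasure_disc_uniform: "emeasure disc_uniform UNIV = 1"
    and radial_disc_uniform: "radial_measure disc_uniform"
    and AE_disc_uniform: "AE w in disc_uniform. w \<noteq> 0"
proof -
  have [measurable]: "(\<lambda>v :: real^2. indicator (cball 0 1) v / pi) \<in> borel_measurable borel"
    by (intro borel_measurable_divide borel_measurable_indicator) auto
  show "sets disc_uniform = sets borel" by (simp add: disc_uniform_def)
  have "emeasure disc_uniform UNIV = (\<integral>\<^sup>+v. ennreal (1 / pi) * indicator (cball 0 1) v \<partial>(lborel :: (real^2) measure))"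
    unfolding disc_uniform_def
    by (subst emeasure_density) (auto intro!: nn_integral_cong split: split_indicator)
  also have "\<dots> = ennreal (1 / pi) * emeasure lborel (cball 0 1 :: (real^2) set)"
    by (rule nn_integral_cmult_indicator) simp
  also have "\<dots> = 1"
    by (simp add: emeasure_cball unit_ball_vol_2 flip: ennreal_mult)
  finally show "emeasure disc_uniform UNIV = 1" .
  show "radial_measure disc_uniform"
    unfolding disc_uniform_def
  proof (rule radial_measure_density)
    show "radial_fun (\<lambda>v. indicator (cball 0 1) v / pi)"
      unfolding radial_fun_def by (simp add: indicator_def)
  qed measurable
  show "AE w in disc_uniform. w \<noteq> 0"
    unfolding disc_uniform_def
    by (subst AE_density) (use AE_lborel_singleton[of "0 :: real^2"] in \<open>auto elim: eventually_mono\<close>)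
qed

lemma finite_borel_disc_uniform: "finite_borel disc_uniform"
  unfolding finite_borel_def
  by (auto simp: sets_disc_uniform intro!: finite_measureI)
     (metis emeasure_disc_uniform ennreal_one_neq_top sets_disc_uniform sets_eq_imp_space_eq space_borel)

text \<open>Complex multiplication; unit vectors act as rotations.\<close>

definition plane_mult :: "real^2 \<Rightarrow> real^2 \<Rightarrow> real^2" where
  "plane_mult u v = (\<chi> i. if i = 1 then u $ 1 * v $ 1 - u $ 2 * v $ 2 else u $ 1 * v $ 2 + u $ 2 * v $ 1)"

lemma vec2_eq_iff: "u = v \<longleftrightarrow> u $ 1 = v $ 1 \<and> u $ 2 = v $ 2" for u v :: "real^2"
  by (simp add: vec_eq_iff forall_2)

lemma plane_mult_commute: "plane_mult u v = plane_mult v u"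
  by (simp add: vec2_eq_iff plane_mult_def)

lemma plane_mult_scaleR: "plane_mult u (c *\<^sub>R v) = c *\<^sub>R plane_mult u v"
  by (simp add: vec2_eq_iff plane_mult_def algebra_simps)

lemma norm_plane_mult: "norm (plane_mult u v) = norm u * norm v"
proof -
  have "(norm (plane_mult u v))\<^sup>2 = (norm u * norm v)\<^sup>2"
    by (simp add: power_mult_distrib flip: dot_square_norm)
       (simp add: inner_vec_def sum_2 plane_mult_def algebra_simps)
  then show ?thesis by (simp add: power2_eq_iff_nonneg)
qed

lemma orthogonal_plane_mult:
  assumes "norm u = 1"
  shows "orthogonal_transformation (plane_mult u)"
  unfolding orthogonal_transformation
proof
  show "linear (plane_mult u)"
    by (rule linearI) (auto simp: vec2_eq_iff plane_mult_def algebra_simps)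
qed (simp add: norm_plane_mult assms)

lemma continuous_plane_mult: "continuous_on UNIV (\<lambda>p. plane_mult (fst p) (snd p))"
proof -
  have "plane_mult u v = (u $ 1 * v $ 1 - u $ 2 * v $ 2) *\<^sub>R axis 1 1 + (u $ 1 * v $ 2 + u $ 2 * v $ 1) *\<^sub>R axis 2 1" for u v
    by (simp add: vec2_eq_iff plane_mult_def axis_def)
  then show ?thesis by (simp only:) (intro continuous_intros)
qed

lemma radial_measure_integral:
  fixes h :: "real^2 \<Rightarrow> real"
  assumes M: "finite_borel M" "radial_measure M" and T: "orthogonal_transformation T"
    and [measurable]: "h \<in> borel_measurable borel"
  shows "(\<integral>v. h (T v) \<partial>M) = (\<integral>v. h v \<partial>M)"
proof -
  note [measurable_cong] = finite_borel_sets[OF M(1)]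
  have [measurable]: "T \<in> borel_measurable borel" by (rule borel_measurable_orthogonal[OF T])
  have "(\<integral>v. h v \<partial>M) = (\<integral>v. h v \<partial>distr M borel T)"
    using M(2) T by (simp add: radial_measure_def)
  also have "\<dots> = (\<integral>v. h (T v) \<partial>M)" by (rule integral_distr) measurable
  finally show ?thesis by simp
qed

text \<open>The mean of \<open>h\<close> over the circle of radius \<open>-ln x\<close>; the value at \<open>x = 0\<close> is the
  limit at infinite radius.\<close>

definition circular_mean :: "(real^2 \<Rightarrow> real) \<Rightarrow> real \<Rightarrow> real" where
  "circular_mean h x = (if x = 0 then 0 else \<integral>w. h ((- ln x) *\<^sub>R sgn w) \<partial>disc_uniform)"

lemma borel_measurable_sgn_vec: "sgn \<in> borel_measurable (borel :: (real^2) measure)"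
  unfolding sgn_div_norm[abs_def] by measurable

text \<open>Dominated convergence over directions. Continuity at x = 0 is where \<open>h\<close>
  vanishing at infinity enters, since the radius \<open>- ln x\<close> then tends to
  infinity.\<close>

lemma continuous_on_circular_mean:
  assumes h: "continuous_on UNIV h" "(h \<longlongrightarrow> 0) at_infinity"
  shows "continuous_on {0..1} (circular_mean h)"
proof -
  define k where "k x w = (if x = 0 then 0 else h ((- ln x) *\<^sub>R sgn w))" for x :: real and w :: "real^2"
  have mean: "circular_mean h x = (\<integral>w. k x w \<partial>disc_uniform)" for x
    by (simp add: circular_mean_def k_def)
  have [measurable]: "h \<in> borel_measurable borel" by (rule borel_measurable_continuous_onI[OF h(1)])
  note [measurable] = borel_measurable_sgn_vec
  have km: "k x \<in> borel_measurable borel" for x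
    unfolding k_def by measurable
  obtain B where B: "\<And>v. \<bar>h v\<bar> \<le> B" using C0_bounded[OF h] by metis
  have kB: "\<bar>k x w\<bar> \<le> B" for x w
    using B[of 0] B by (auto simp: k_def intro: order_trans[OF abs_ge_zero])
  \<comment> \<open>At w = 0 the direction \<open>sgn w\<close> is 0 and the integrand would jump
    from \<open>h 0\<close> to 0 at x = 0; this point is null.\<close>
  have cont: "continuous_on {0..1} (\<lambda>x. k x w)" if w: "w \<noteq> 0" for w
    unfolding continuous_on_def
  proof
    fix x :: real assume x: "x \<in> {0..1}"
    show "((\<lambda>x. k x w) \<longlongrightarrow> k x w) (at x within {0..1})"
    proof (cases "x = 0")
      case True
      have "filterlim (\<lambda>x. - ln x) at_top (at_right (0::real))"
        using ln_at_0 by (simp add: filterlim_uminus_at_bot)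
      from filterlim_compose[OF filterlim_abs_real this]
      have "filterlim (\<lambda>x. (- ln x) *\<^sub>R sgn w) at_infinity (at_right (0::real))"
        unfolding filterlim_at_infinity_conv_norm_at_top using w
        by (simp add: norm_sgn)
      then have "((\<lambda>x. h ((- ln x) *\<^sub>R sgn w)) \<longlongrightarrow> 0) (at_right 0)"
        by (rule filterlim_compose[OF h(2)])
      then have "((\<lambda>x. k x w) \<longlongrightarrow> 0) (at_right 0)"
        by (rule filterlim_cong[THEN iffD1, rotated -1])
           (auto simp: k_def eventually_at_right_field intro!: exI[of _ 1])
      then show ?thesis using True by (simp add: k_def at_within_Icc_at_right)
    next
      case False
      then have x: "x > 0" using x by simp
      have hc: "isCont h y" for y using h(1) by (simp add: continuous_on_eq_continuous_at)
      have "((\<lambda>x. h ((- ln x) *\<^sub>R sgn w)) \<longlongrightarrow> h ((- ln x) *\<^sub>R sgn w)) (at x)"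
        using x by (intro isCont_tendsto_compose[OF hc] tendsto_intros) auto
      then have "((\<lambda>x. k x w) \<longlongrightarrow> k x w) (at x)"
        using x by (intro Lim_transform_within_open[of _ _ x UNIV "{0<..}" "\<lambda>x. k x w"]) (auto simp: k_def)
      then show ?thesis by (rule tendsto_within_subset) simp
    qed
  qed
  show ?thesis
  proof (rule continuous_on_sequentiallyI)
    fix X :: "nat \<Rightarrow> real" and x
    assume X: "\<forall>n. X n \<in> {0..1}" "x \<in> {0..1}" "X \<longlonglongrightarrow> x"
    show "(\<lambda>n. circular_mean h (X n)) \<longlonglongrightarrow> circular_mean h x"
      unfolding mean
    proof (rule integral_dominated_convergence[where w = "\<lambda>_. B"])
      show "k x \<in> borel_measurable disc_uniform" "k (X n) \<in> borel_measurable disc_uniform" for n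
        using km measurable_cong_sets[OF sets_disc_uniform refl] by blast+
      show "AE w in disc_uniform. (\<lambda>n. k (X n) w) \<longlonglongrightarrow> k x w"
        using AE_disc_uniform
      proof eventually_elim
        case (elim w)
        show ?case
          using continuous_on_tendsto_compose[OF cont[OF elim] X(3,2)] X(1) by simp
      qed
      show "integrable disc_uniform (\<lambda>_. B)"
        by (rule integrable_bounded[OF finite_borel_disc_uniform, of _ "\<bar>B\<bar>"]) auto
    qed (use kB in auto)
  qed
qed

text \<open>Average \<open>\<integral>h dM\<close> over the rotations by \<open>w/|w|\<close>, \<open>w\<close> uniform in the disc. After Fubini,
  rotating \<open>w\<close> instead of \<open>v\<close> leaves a function of \<open>|v|\<close> only.\<close>

lemma integral_circular_mean:
  assumes M: "finite_borel M" "radial_measure M" and h: "continuous_on UNIV h" "(h \<longlongrightarrow> 0) at_infinity"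
  shows "(\<integral>v. h v \<partial>M) = (\<integral>v. circular_mean h (exp (- norm v)) \<partial>M)"
proof -
  let ?D = disc_uniform
  interpret M: finite_measure M by (rule finite_borel_finite[OF M(1)])
  interpret D: finite_measure ?D by (rule finite_borel_finite[OF finite_borel_disc_uniform])
  interpret pair_sigma_finite ?D M
    by (intro pair_sigma_finite.intro M.sigma_finite_measure_axioms D.sigma_finite_measure_axioms)
  note [measurable_cong] = finite_borel_sets[OF M(1)] sets_disc_uniform
  have [measurable]: "h \<in> borel_measurable borel" by (rule borel_measurable_continuous_onI[OF h(1)])
  note [measurable] = borel_measurable_sgn_vec
  have [measurable]: "(\<lambda>x. plane_mult (a x) (b x)) \<in> borel_measurable L"
    if "a \<in> borel_measurable L" "b \<in> borel_measurable L" for a b and L :: "'z measure"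
    by (rule borel_measurable_continuous_Pair[OF that continuous_plane_mult])
  obtain B where B: "\<And>v. \<bar>h v\<bar> \<le> B" using C0_bounded[OF h] by metis
  have mass: "measure ?D (space ?D) = 1"
    using emeasure_disc_uniform sets_eq_imp_space_eq[OF sets_disc_uniform]
    by (simp add: measure_def)
  have "(\<integral>v. h v \<partial>M) = (\<integral>w. (\<integral>v. h v \<partial>M) \<partial>?D)"
    by (simp add: mass)
  also have "\<dots> = (\<integral>w. (\<integral>v. h (plane_mult (sgn w) v) \<partial>M) \<partial>?D)"
  proof (rule integral_cong_AE)
    show "AE w in ?D. (\<integral>v. h v \<partial>M) = (\<integral>v. h (plane_mult (sgn w) v) \<partial>M)"
      using AE_disc_uniform
    proof eventually_elim
      case (elim w)
      then have "orthogonal_transformation (plane_mult (sgn w))"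
        by (intro orthogonal_plane_mult) (simp add: norm_sgn)
      from radial_measure_integral[OF M this, of h] show ?case by simp
    qed
  qed measurable
  also have "\<dots> = (\<integral>v. (\<integral>w. h (plane_mult (sgn w) v) \<partial>?D) \<partial>M)"
  proof (rule Fubini_integral[symmetric])
    interpret DM: finite_measure "?D \<Otimes>\<^sub>M M"
      by (intro finite_measure_pair_measure) unfold_locales
    show "integrable (?D \<Otimes>\<^sub>M M) (\<lambda>(w, v). h (plane_mult (sgn w) v))"
      by (rule DM.integrable_const_bound[where B = B]) (use B in \<open>auto simp: case_prod_beta\<close>)
  qed
  also have "\<dots> = (\<integral>v. circular_mean h (exp (- norm v)) \<partial>M)"
  proof (rule Bochner_Integration.integral_cong[OF refl])
    fix v :: "real^2"
    have mean: "circular_mean h (exp (- norm v)) = (\<integral>w. h (norm v *\<^sub>R sgn w) \<partial>?D)"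
      by (simp add: circular_mean_def)
    show "(\<integral>w. h (plane_mult (sgn w) v) \<partial>?D) = circular_mean h (exp (- norm v))"
    \<comment> \<open>For v = 0 the vector \<open>sgn v\<close> is no rotation, but both integrands
      are constantly \<open>h 0\<close>.\<close>
    proof (cases "v = 0")
      case True
      then show ?thesis unfolding mean
        using plane_mult_scaleR[of _ 0 0] by simp
    next
      case False
      then have o: "orthogonal_transformation (plane_mult (sgn v))"
        by (intro orthogonal_plane_mult) (simp add: norm_sgn)
      \<comment> \<open>Commutativity of complex multiplication exchanges the roles of
        \<open>v\<close> and \<open>w\<close>; at w = 0 both sides are 0.\<close>
      have "plane_mult (sgn w) v = norm v *\<^sub>R sgn (plane_mult (sgn v) w)" for w
      proof -
        have "plane_mult (sgn w) v = norm v *\<^sub>R plane_mult (sgn w) (sgn v)"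
          using False by (simp add: sgn_div_norm flip: plane_mult_scaleR)
        also have "plane_mult (sgn w) (sgn v) = plane_mult (sgn v) (sgn w)"
          by (rule plane_mult_commute)
        also have "\<dots> = plane_mult (sgn v) w /\<^sub>R norm w"
          unfolding sgn_div_norm[of w] plane_mult_scaleR ..
        also have "\<dots> = sgn (plane_mult (sgn v) w)"
          using False by (simp add: sgn_div_norm[of "plane_mult (sgn v) w"] norm_plane_mult norm_sgn)
        finally show ?thesis .
      qed
      then show ?thesis
        unfolding mean
        using radial_measure_integral[OF finite_borel_disc_uniform radial_disc_uniform o,
            of "\<lambda>w. h (norm v *\<^sub>R sgn w)"] by simp
    qed
  qed
  finally show ?thesis .
qed

text \<open>By radial symmetry each test function may be replaced by its circular mean, a continuous
  profile in e^(-|v|) that vanishes at 0.\<close>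

lemma converges_on_C0I:
  assumes M: "\<And>k. finite_borel (M k)" "\<And>k. radial_measure (M k)" and N: "finite_borel N" "radial_measure N"
    and C: "\<And>k. measure (M k) UNIV \<le> C"
    and ae: "AE r in lborel. (\<lambda>k. measure (M k) (cball 0 r)) \<longlonglongrightarrow> measure N (cball 0 r)"
  shows "converges_on_C0 M N"
  unfolding converges_on_C0_def
proof (intro allI impI, elim conjE)
  fix h :: "real^2 \<Rightarrow> real" assume h: "continuous_on UNIV h" "(h \<longlongrightarrow> 0) at_infinity"
  let ?C = "max C (measure N UNIV)"
  have "measure (M k) UNIV \<le> ?C" for k using C[of k] by simp
  then show "(\<lambda>k. \<integral>v. h v \<partial>M k) \<longlonglongrightarrow> (\<integral>v. h v \<partial>N)"
    unfolding integral_circular_mean[OF M h] integral_circular_mean[OF N h]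
    by (intro integral_profile_tendsto[where C = ?C] M N ae continuous_on_circular_mean h)
       (auto simp: circular_mean_def)
qed

text \<open>Weak-* convergence of radial measures amounts to bounded masses and convergence of
  almost all ball masses, and this is preserved by a continuous monotone change of the ball masses.\<close>

lemma converges_on_C0_transfer:
  assumes M: "\<And>k. finite_borel (M k)" and M0: "finite_borel M0"
    and N: "\<And>k. finite_borel (N k)" "\<And>k. radial_measure (N k)"
    and N0: "finite_borel N0" "radial_measure N0"
    and a: "continuous_on {0..} a" "mono_on {0..} a"
    and eq: "\<And>k r. r \<ge> 0 \<Longrightarrow> measure (N k) (cball 0 r) = a (measure (M k) (cball 0 r))"
      "\<And>r. r \<ge> 0 \<Longrightarrow> measure N0 (cball 0 r) = a (measure M0 (cball 0 r))"
    and conv: "converges_on_C0 M M0"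
  shows "converges_on_C0 N N0"
proof -
  obtain C where C: "\<And>k. measure (M k) UNIV \<le> C"
    using converges_on_C0_bounded_mass[OF M conv] by metis
  have CM: "measure (M k) (cball 0 r) \<le> C" for k r
    using measure_cball_le_UNIV[OF M, of k r] C[of k] by simp
  then have C0: "C \<ge> 0" by (rule order_trans[OF measure_nonneg])
  have "measure (N k) UNIV \<le> a C" for k
    by (rule measure_UNIV_le[OF N(1)]) (use CM C0 in \<open>auto simp: eq intro!: mono_onD[OF a(2)]\<close>)
  moreover have "AE r in lborel. (\<lambda>k. measure (N k) (cball 0 r)) \<longlonglongrightarrow> measure N0 (cball 0 r)"
  proof -
    \<comment> \<open>The exceptional radii are read off from the limit \<open>M0\<close> on the
      source side, and continuity of \<open>a\<close> carries the convergence over to the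
      target.\<close>
    have "countable {r. \<not> isCont (\<lambda>r. measure M0 (cball 0 r)) r}"
      by (rule mono_ctble_discont[OF measure_cball_mono[OF M0]])
    then have "AE r in lborel. r \<notin> {r. \<not> isCont (\<lambda>r. measure M0 (cball 0 r)) r}"
      by (intro AE_not_in countable_imp_null_set_lborel)
    then show ?thesis
    proof eventually_elim
      case (elim r)
      then have lim: "(\<lambda>k. measure (M k) (cball 0 r)) \<longlonglongrightarrow> measure M0 (cball 0 r)"
        by (intro converges_on_C0_cball[OF M M0 conv]) simp
      show ?case
      proof (cases "r \<ge> 0")
        case True
        show ?thesis
          unfolding eq[OF True] by (rule continuous_on_tendsto_compose[OF a(1) lim]) auto
      qed simp
    qed
  qed
  ultimately show ?thesis by (intro converges_on_C0I N N0)
qed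

section \<open>Transfer of the initial condition\<close>

lemma density_finite_borel:
  fixes u :: "real^2 \<Rightarrow> real"
  assumes "integrable lborel u" "\<And>v. u v \<ge> 0"
  shows "finite_borel (density lborel (\<lambda>v. ennreal (u v)))"
proof -
  have "(\<integral>\<^sup>+v. ennreal (u v) \<partial>lborel) < \<infinity>"
    using assms integrable_iff_bounded[of lborel u] by simp
  moreover have "u \<in> borel_measurable lborel" using assms(1) by (rule borel_measurable_integrable)
  ultimately show ?thesis
    by (auto simp: finite_borel_def emeasure_density intro!: finite_measureI)
qed

lemma integral_density_mult:
  fixes h u :: "real^2 \<Rightarrow> real"
  assumes "continuous_on UNIV h" "continuous_on UNIV u" "\<And>v. u v \<ge> 0"
  shows "(\<integral>v. h v \<partial>density lborel (\<lambda>v. ennreal (u v))) = (\<integral>v. h v * u v \<partial>lborel)"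
  using assms borel_measurable_continuous_onI
  by (subst integral_density) (auto simp: mult.commute)

text \<open>Finiteness of the mass is itself part of the initial condition. The ball masses of
  \<open>w\<close> are bounded by \<open>a\<close> of the total mass of \<open>u\<close>, and the
  balls exhaust the plane.\<close>

lemma integrable_radial_transfer:
  assumes cont: "continuous_on UNIV u" "continuous_on UNIV w" and rad: "radial_fun u" "radial_fun w"
    and nonneg: "\<And>v. u v \<ge> 0" "\<And>v. w v \<ge> 0" and a: "mono_on {0..} a"
    and eq: "\<And>v. 2 * pi * radial_primitive w v = a (2 * pi * radial_primitive u v)"
    and int: "integrable lborel u"
  shows "integrable lborel w"
proof (rule integrableI_nonneg)
  let ?U = "density lborel (\<lambda>v. ennreal (u v))" and ?W = "density lborel (\<lambda>v. ennreal (w v))"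
  have wm: "w \<in> borel_measurable borel" by (rule borel_measurable_continuous_onI[OF cont(2)])
  then show "w \<in> borel_measurable lborel" by simp
  have U: "finite_borel ?U" by (rule density_finite_borel[OF int nonneg(1)])
  let ?e = "axis 1 1 :: real^2"
  have "emeasure ?W (cball 0 (real n)) \<le> ennreal (a (measure ?U UNIV))" for n
  proof -
    have "2 * pi * radial_primitive u (real n *\<^sub>R ?e) = measure ?U (cball 0 (real n))"
      using emeasure_radial_density_cball[OF cont(1) rad(1) nonneg(1), of "real n" ?e]
        radial_primitive_nonneg[of u, OF nonneg(1)]
      by (simp add: measure_def)
    moreover have "emeasure ?W (cball 0 (real n)) = ennreal (2 * pi * radial_primitive w (real n *\<^sub>R ?e))"
      by (rule emeasure_radial_density_cball[OF cont(2) rad(2) nonneg(2)]) auto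
    ultimately show ?thesis
      unfolding eq
      by (auto intro!: ennreal_leI mono_onD[OF a] measure_cball_le_UNIV[OF U])
  qed
  moreover have "(\<lambda>n. emeasure ?W (cball 0 (real n))) \<longlonglongrightarrow> emeasure ?W (\<Union>n. cball 0 (real n))"
    by (rule Lim_emeasure_incseq) (auto simp: incseq_def)
  moreover have "(\<Union>n. cball 0 (real n)) = (UNIV :: (real^2) set)"
    using real_arch_simple by auto
  ultimately have "emeasure ?W UNIV \<le> ennreal (a (measure ?U UNIV))"
    by (metis (no_types, lifting) LIMSEQ_le_const2)
  also have "\<dots> < \<infinity>" by simp
  finally show "(\<integral>\<^sup>+v. ennreal (w v) \<partial>lborel) < \<infinity>"
    using wm by (simp add: emeasure_density)
qed (use nonneg in simp)

lemma weak_star_initial_transfer: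
  assumes u0: "finite_borel u0" and w0: "finite_borel w0" "radial_measure w0"
    and cont: "continuous_pos_time u" "continuous_pos_time w"
    and rad: "\<And>t. t > 0 \<Longrightarrow> radial_fun (u t)" "\<And>t. t > 0 \<Longrightarrow> radial_fun (w t)"
    and nonneg: "\<And>t v. t > 0 \<Longrightarrow> u t v \<ge> 0" "\<And>t v. t > 0 \<Longrightarrow> w t v \<ge> 0"
    and a: "continuous_on {0..} a" "mono_on {0..} a"
    and eq: "\<And>t v. t > 0 \<Longrightarrow> 2 * pi * radial_primitive (w t) v = a (2 * pi * radial_primitive (u t) v)"
    and eq0: "\<And>r. r \<ge> 0 \<Longrightarrow> measure w0 (cball 0 r) = a (measure u0 (cball 0 r))"
    and init: "weak_star_initial u u0"
  shows "weak_star_initial w w0"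
proof -
  let ?U = "\<lambda>t. density lborel (\<lambda>v. ennreal (u t v))" and ?W = "\<lambda>t. density lborel (\<lambda>v. ennreal (w t v))"
  note cu = continuous_pos_time_section[OF cont(1)] and cw = continuous_pos_time_section[OF cont(2)]
  have int: "integrable lborel (w t)" if "t > 0" "integrable lborel (u t)" for t
    by (rule integrable_radial_transfer[OF cu cw rad nonneg a(2) eq]) (use that in auto)
  have ev: "\<forall>\<^sub>F t in at_right 0. t > 0 \<and> integrable lborel (u t)"
    using init eventually_at_right_less[of "0::real"]
    by (auto simp: weak_star_initial_def elim: eventually_elim2)
  have cball: "measure (density lborel (\<lambda>v. ennreal (k v))) (cball 0 r) = 2 * pi * radial_primitive k (r *\<^sub>R axis 1 1)"
    if "continuous_on UNIV k" "radial_fun k" "\<And>v. k v \<ge> 0" "r \<ge> 0" for k r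
    using emeasure_radial_density_cball[OF that, of "axis 1 1"] radial_primitive_nonneg[of k, OF that(3)]
    by (simp add: measure_def)
  show ?thesis
    unfolding weak_star_initial_def
  proof (intro conjI allI impI)
    show "\<forall>\<^sub>F t in at_right 0. integrable lborel (w t)"
      using ev by eventually_elim (use int in blast)
    fix h :: "real^2 \<Rightarrow> real"
    assume h: "continuous_on UNIV h \<and> (h \<longlongrightarrow> 0) at_infinity"
    show "((\<lambda>t. \<integral>v. h v * w t v \<partial>lborel) \<longlongrightarrow> (\<integral>v. h v \<partial>w0)) (at_right 0)"
      unfolding tendsto_at_iff_sequentially
    proof (intro allI impI)
      fix X :: "nat \<Rightarrow> real"
      assume X: "\<forall>i. X i \<in> {0<..} - {0}" "X \<longlonglongrightarrow> 0"
      have Xpos: "X i > 0" "X i \<noteq> 0" for i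
        using X(1) by (auto simp: less_imp_neq[symmetric])
      have fX: "filterlim X (at_right 0) sequentially"
        using X(2) Xpos by (simp add: filterlim_at)
      \<comment> \<open>Integrability holds only for small times; dropping the first
        \<open>K\<close> terms makes every density a finite measure, and
        \<open>LIMSEQ_offset\<close> restores them in the limit.\<close>
      obtain K where K: "\<And>k. k \<ge> K \<Longrightarrow> X k > 0 \<and> integrable lborel (u (X k))"
        using eventually_compose_filterlim[OF ev fX] by (auto simp: eventually_sequentially)
      define Y where "Y k = X (k + K)" for k
      have Y: "Y k > 0" "integrable lborel (u (Y k))" for k
        using K[of "k + K"] by (auto simp: Y_def)
      have fY: "filterlim Y (at_right 0) sequentially"
        unfolding Y_def using filterlim_compose[OF fX filterlim_add_const_nat_at_top] by simp
      have "converges_on_C0 (\<lambda>k. ?U (Y k)) u0"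
        unfolding converges_on_C0_def
      proof (intro allI impI)
        fix h :: "real^2 \<Rightarrow> real"
        assume h: "continuous_on UNIV h \<and> (h \<longlongrightarrow> 0) at_infinity"
        have "((\<lambda>t. \<integral>v. h v * u t v \<partial>lborel) \<longlongrightarrow> (\<integral>v. h v \<partial>u0)) (at_right 0)"
          using init h by (simp add: weak_star_initial_def)
        from filterlim_compose[OF this fY] h
        show "(\<lambda>k. \<integral>v. h v \<partial>?U (Y k)) \<longlonglongrightarrow> (\<integral>v. h v \<partial>u0)"
          by (simp add: integral_density_mult cu Y(1) nonneg(1))
      qed
      then have "converges_on_C0 (\<lambda>k. ?W (Y k)) w0"
      proof (rule converges_on_C0_transfer[OF _ u0 _ _ w0 a, rotated -1])
        fix k :: nat
        note Yk = Y(1)[of k]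
        show "finite_borel (?U (Y k))" "finite_borel (?W (Y k))"
          by (intro density_finite_borel int Y nonneg Yk)+
        show "radial_measure (?W (Y k))"
          by (intro radial_measure_density borel_measurable_continuous_onI cw rad Yk)
        show "measure (?W (Y k)) (cball 0 r) = a (measure (?U (Y k)) (cball 0 r))" if "r \<ge> 0" for r
          by (simp add: cball cu cw rad nonneg Yk that eq)
      qed (rule eq0)
      then have "(\<lambda>k. \<integral>v. h v * w (Y k) v \<partial>lborel) \<longlonglongrightarrow> (\<integral>v. h v \<partial>w0)"
        using h by (simp add: converges_on_C0_def integral_density_mult cw Y(1) nonneg(2))
      then show "((\<lambda>t. \<integral>v. h v * w t v \<partial>lborel) \<circ> X) \<longlonglongrightarrow> (\<integral>v. h v \<partial>w0)"
        unfolding Y_def o_def by (rule LIMSEQ_offset)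
    qed
  qed
qed

theorem theorem2p6:
  fixes f\<^sub>0 g\<^sub>0 :: "(real^2) measure"
    and f g :: "real \<Rightarrow> real^2 \<Rightarrow> real"
    and \<phi> \<psi> :: "real \<Rightarrow> real \<Rightarrow> real"
  assumes "sets f\<^sub>0 = sets borel" and "finite_measure f\<^sub>0" and "radial_measure f\<^sub>0"
    and "sets g\<^sub>0 = sets borel" and "finite_measure g\<^sub>0" and "radial_measure g\<^sub>0"
    and "\<forall>r\<ge>0. 1 / (2 * pi) * measure f\<^sub>0 (cball 0 r)
                = ln (1 + 1 / (2 * pi) * measure g\<^sub>0 (cball 0 r))"
    and "\<forall>t>0. \<forall>v. f t v \<ge> 0" and "\<forall>t>0. radial_fun (f t)"
    and "\<forall>t>0. \<forall>v. g t v \<ge> 0" and "\<forall>t>0. radial_fun (g t)"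
    and "\<forall>t>0. related_by_profiles (f t) (g t) (\<phi> t) (\<psi> t)"
  shows "classical_solution bose_einstein_fokker_planck f f\<^sub>0
         \<longleftrightarrow> classical_solution linear_fokker_planck g g\<^sub>0"
proof -
  \<comment> \<open>Ball masses are 2 pi times the primitives, so these mutually inverse maps are
    e^(n_f) = 1 + n_g expressed in masses. They serve the two directions of the transfer.\<close>
  let ?aexp = "\<lambda>x. 2 * pi * (exp (x / (2 * pi)) - 1)" and ?aln = "\<lambda>x. 2 * pi * ln (1 + x / (2 * pi))"
  have f0: "finite_borel f\<^sub>0" and g0: "finite_borel g\<^sub>0"
    using assms by (auto simp: finite_borel_def)
  have nf: "\<And>t v. t > 0 \<Longrightarrow> f t v \<ge> 0" and ng: "\<And>t v. t > 0 \<Longrightarrow> g t v \<ge> 0"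
    and rf: "\<And>t. t > 0 \<Longrightarrow> radial_fun (f t)" and rg: "\<And>t. t > 0 \<Longrightarrow> radial_fun (g t)"
    using assms(8-11) by blast+
  have E: "exp (radial_primitive (f t) v) = 1 + radial_primitive (g t) v"
    and g: "g t v = f t v * exp (radial_primitive (f t) v)" if "t > 0" for t v
    using related_by_profiles_imp[of "f t" "g t" "\<phi> t" "\<psi> t" v] assms(12) rf rg that by blast+
  have f: "f t v = g t v * inverse (1 + radial_primitive (g t) v)" if "t > 0" for t v
    using g[OF that, of v] by (simp add: field_simps flip: E[OF that])
  have C: "C1t_C2v f \<longleftrightarrow> C1t_C2v g"
    using C1t_C2v_exp_transform[of f g, OF _ rf g] C1t_C2v_log_transform[of g f, OF _ rg ng f] by blast
  have nP: "radial_primitive (g t) v \<ge> 0" if "t > 0" for t v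
    by (rule radial_primitive_nonneg) (rule ng[OF that])
  have mono: "mono_on {0..} ?aexp" "mono_on {0..} ?aln"
    by (auto intro!: mono_onI simp: divide_right_mono add_pos_nonneg)
  have cont: "continuous_on {0..} ?aexp" "continuous_on {0..} ?aln"
    by (auto intro!: continuous_intros simp: add_nonneg_eq_0_iff)
  have ball_f: "measure f\<^sub>0 (cball 0 r) = ?aln (measure g\<^sub>0 (cball 0 r))" if "r \<ge> 0" for r
    using assms(7) that by (simp add: field_simps)
  have ball_g: "measure g\<^sub>0 (cball 0 r) = ?aexp (measure f\<^sub>0 (cball 0 r))" if "r \<ge> 0" for r
  proof -
    have "measure f\<^sub>0 (cball 0 r) / (2 * pi) = ln (1 + measure g\<^sub>0 (cball 0 r) / (2 * pi))"
      using ball_f[OF that] by simp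
    moreover have "1 + measure g\<^sub>0 (cball 0 r) / (2 * pi) > 0" by (intro add_pos_nonneg) auto
    ultimately show ?thesis by simp
  qed
  have prim_g: "2 * pi * radial_primitive (g t) v = ?aexp (2 * pi * radial_primitive (f t) v)" if "t > 0" for t v
    using E[OF that, of v] by simp
  have prim_f: "2 * pi * radial_primitive (f t) v = ?aln (2 * pi * radial_primitive (g t) v)" if "t > 0" for t v
    by (simp flip: E[OF that])
  \<comment> \<open>The transfer needs \<open>f\<close> and \<open>g\<close> continuous in order to
    identify ball masses with primitives, so it is conditional on regularity, which \<open>C\<close>
    supplies for both from either one.\<close>
  have init: "weak_star_initial f f\<^sub>0 \<longleftrightarrow> weak_star_initial g g\<^sub>0" if "C1t_C2v f" "C1t_C2v g"
    using weak_star_initial_transfer[OF f0 g0 assms(6) C1t_C2v_continuous(1)[OF that(1)]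
        C1t_C2v_continuous(1)[OF that(2)] rf rg nf ng cont(1) mono(1) prim_g ball_g]
      weak_star_initial_transfer[OF g0 f0 assms(3) C1t_C2v_continuous(1)[OF that(2)]
        C1t_C2v_continuous(1)[OF that(1)] rg rf ng nf cont(2) mono(2) prim_f ball_f]
    by blast
  have pde: "(\<forall>t>0. \<forall>v. time_deriv f t v = bose_einstein_fokker_planck (f t) v) \<longleftrightarrow>
      (\<forall>t>0. \<forall>v. time_deriv g t v = linear_fokker_planck (g t) v)" if "C1t_C2v f"
    by (rule pde_equivalence[OF that rf rg g E])
  show ?thesis
    unfolding classical_solution_def by (metis C init pde)
qed

end
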